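(* Let $d\geqslant 0$ be an integer and let $f$ be a normalized function on flags. Then the simple valuation $\mu_f$ is polynomial of degree $\leqslant d$ if and only if $f$ satisfies the following two properties: (1) $\deg(f_L)\leqslant d+2$ for every line $L$ through the origin $o$; (2) if $a,b\in\mathbb{R}^2$ are such that $a-b$ is vertical, and $L_a$, $L_b$ are the lines connecting $o$ with $a$, $b$, respectively, then $\Delta_a f_{L_a}-\Delta_b f_{L_b}$ is a polynomial function of degree $\leqslant d$.
   Context: Fix an orientation of $\mathbb{R}^2$ and two distinct lines $L_0,L_1\subset\mathbb{R}^2$ through the origin $o$ ("horizontal" and "vertical" line). A vector is vertical if it lies in $L_1$. Polynomial functions. Let $A$ be an abelian group. A function $\varphi:A\to\mathbb{R}$ is polynomial of degree $\leqslant 0$ if it is constant; inductively, for $d\geqslant 1$, it is polynomial of degree $\leqslant d$ if for each $a\in A$ the function $\Delta_a\varphi(x):=\varphi(x+a)-\varphi(x)$ is polynomial of degree $\leqslant d-1$. (No continuity is required.) We write $\deg(\varphi)\leqslant d$ for this. Valuations. A convex polygon means a compact convex polygon in $\mathbb{R}^2$ with nonempty interior. A simple valuation on plane polygons is a real-valued function $\mu$ on the set of convex polygons such that $\mu(P)=\mu(P_1)+\dots+\mu(P_n)$ whenever a convex polygon $P$ is the union of convex polygons $P_1,\dots,P_n$ with pairwise disjoint interiors. It is polynomial of degree $\leqslant d$ if, for every convex polygon $P$, the function $v\mapsto\mu(P+v)$ on $\mathbb{R}^2$ is polynomial of degree $\leqslant d$. Flags. A flag is a pair $(a,L)$ where $L$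 is an affine line in $\mathbb{R}^2$ and $a\in L$ is a point. The flag valuation $\Upsilon_{a,L}$ takes value $0$ on a convex polygon $P$ unless $a$ is a vertex of $P$ and $L$ contains an edge of $P$; in the latter case $\Upsilon_{a,L}(P)=+1$ or $-1$ according to whether the rotation around $a$ from the edge $P\cap L$ towards the interior of $P$ is positive or negative. For a real-valued function $f$ on flags, $\mu_f:=\sum_{(a,L)}f(a,L)\Upsilon_{a,L}$ (only finitely many terms are nonzero on any given polygon); $\mu_f$ is a simple valuation. A function $f$ on flags is normalized if $f(a,L)=0$ whenever $L$ is parallel to $L_1$, or $L=L_0$, or $a\in L_1$. For a line $L\ni o$, $f_L:\mathbb{R}^2\to\mathbb{R}$ is defined by $f_L(a):=f(a,L+a)$. Convention: if $a=o$, the line $L_a$ is not determined, but $\Delta_a$ is the zero operator, so the term $\Delta_a f_{L_a}$ is $0$; similarly for $b$. *)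

theory Defs
  imports "HOL-Analysis.Analysis"
begin

definition Delta :: "'a::ab_group_add \<Rightarrow> ('a \<Rightarrow> real) \<Rightarrow> 'a \<Rightarrow> real" where
  "Delta a \<phi> = (\<lambda>x. \<phi> (x + a) - \<phi> x)"

primrec poly_deg_le :: "nat \<Rightarrow> ('a::ab_group_add \<Rightarrow> real) \<Rightarrow> bool" where
  "poly_deg_le 0 \<phi> \<longleftrightarrow> (\<exists>c. \<forall>x. \<phi> x = c)"
| "poly_deg_le (Suc d) \<phi> \<longleftrightarrow> (\<forall>a. poly_deg_le d (Delta a \<phi>))"

definition convex_polygon :: "(real^2) set \<Rightarrow> bool" where
  "convex_polygon P \<longleftrightarrow> polytope P \<and> interior P \<noteq> {}"

text \<open>Valuations are functions on convex polygons only: their values on other sets are never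
  used. Convex polygons with pairwise disjoint interiors are distinct, because each interior is
  nonempty, so a dissection is rendered as a finite set of pieces.\<close>

definition simple_valuation :: "((real^2) set \<Rightarrow> real) \<Rightarrow> bool" where
  "simple_valuation \<mu> \<longleftrightarrow>
     (\<forall>P \<Q>. convex_polygon P \<and> finite \<Q> \<and> (\<forall>Q\<in>\<Q>. convex_polygon Q) \<and> P = \<Union>\<Q> \<and>
        pairwise (\<lambda>Q R. interior Q \<inter> interior R = {}) \<Q> \<longrightarrow> \<mu> P = (\<Sum>Q\<in>\<Q>. \<mu> Q))"

definition poly_valuation_deg_le :: "nat \<Rightarrow> ((real^2) set \<Rightarrow> real) \<Rightarrow> bool" where
  "poly_valuation_deg_le d \<mu> \<longleftrightarrow>
     simple_valuation \<mu> \<and> (\<forall>P. convex_polygon P \<longrightarrow> poly_deg_le d (\<lambda>v. \<mu> ((+) v ` P)))"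

definition affine_line :: "(real^2) set \<Rightarrow> bool" where
  "affine_line L \<longleftrightarrow> affine L \<and> aff_dim L = 1"

definition flags :: "((real^2) \<times> (real^2) set) set" where
  "flags = {(a, L). affine_line L \<and> a \<in> L}"

text \<open>An orientation of the plane is given by a sign \<open>s \<in> {1, -1}\<close>, where \<open>1\<close> is the orientation
  of the standard basis; \<open>u\<close>, \<open>v\<close> is a positively oriented basis iff the following holds.\<close>

definition positive_basis :: "real \<Rightarrow> real^2 \<Rightarrow> real^2 \<Rightarrow> bool" where
  "positive_basis s u v \<longleftrightarrow> s * det (vector [u, v] :: real^2^2) > 0"

text \<open>If \<open>a\<close> is a vertex of \<open>P\<close> and \<open>L \<ni> a\<close> contains an edge of \<open>P\<close>, then the interior of \<open>P\<close> lies
  strictly on one side of \<open>L\<close> and \<open>a\<close> is an endpoint of the edge \<open>P \<inter> L\<close>. So the orientation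
  of \<open>(b - a, c - a)\<close> is the same for all \<open>b\<close> and \<open>c\<close> below; it is the sense of the rotation around
  \<open>a\<close>, by an angle less than \<open>\<pi>\<close>, from the edge towards the interior.\<close>

definition Upsilon :: "real \<Rightarrow> real^2 \<Rightarrow> (real^2) set \<Rightarrow> (real^2) set \<Rightarrow> real" where
  "Upsilon s a L P =
     (if a extreme_point_of P \<and> (\<exists>E. E edge_of P \<and> E \<subseteq> L)
      then if \<forall>b \<in> (P \<inter> L) - {a}. \<forall>c \<in> interior P. positive_basis s (b - a) (c - a) then 1 else -1
      else 0)"

text \<open>Functions on flags are curried and total; only their values on \<^const>\<open>flags\<close> matter. The
  index set of the following sum is finite for every convex polygon \<open>P\<close>.\<close>

definition flag_valuation ::
  "real \<Rightarrow> (real^2 \<Rightarrow> (real^2) set \<Rightarrow> real) \<Rightarrow> (real^2) set \<Rightarrow> real" where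
  "flag_valuation s f P =
     (\<Sum>(a, L) \<in> {(a, L). (a, L) \<in> flags \<and> Upsilon s a L P \<noteq> 0}. f a L * Upsilon s a L P)"

definition normalized ::
  "(real^2) set \<Rightarrow> (real^2) set \<Rightarrow> (real^2 \<Rightarrow> (real^2) set \<Rightarrow> real) \<Rightarrow> bool" where
  "normalized L\<^sub>0 L\<^sub>1 f \<longleftrightarrow>
     (\<forall>(a, L) \<in> flags. affine_parallel L L\<^sub>1 \<or> L = L\<^sub>0 \<or> a \<in> L\<^sub>1 \<longrightarrow> f a L = 0)"

definition flag_slice ::
  "(real^2 \<Rightarrow> (real^2) set \<Rightarrow> real) \<Rightarrow> (real^2) set \<Rightarrow> real^2 \<Rightarrow> real" where
  "flag_slice f L a = f a ((+) a ` L)"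

text \<open>The line connecting the origin with \<open>a\<close>. For \<open>a = 0\<close> this is the junk value \<open>{0}\<close>, which is
  harmless: it is only used below \<^const>\<open>Delta\<close> \<open>a\<close>, which is then the zero operator.\<close>

definition line_to :: "real^2 \<Rightarrow> (real^2) set" where
  "line_to a = affine hull {0, a}"

end

theory Submission
  imports Defs
begin

text \<open>Traversing the boundary of a polygon, each edge \<open>[p, q]\<close> carries two flags on the same line and
  with opposite signs, so it contributes, up to a common sign, the increment of \<open>f\<close> from \<open>p\<close> to \<open>q\<close>. Translating the
  polygon by \<open>x\<close>, this becomes \<open>I e (x + p)\<close>, where \<open>e = q - p\<close> and \<open>I e = \<Delta>\<^sub>e f\<^sub>L\<close> for the line \<open>L\<close>
  spanned by \<open>e\<close>. Since every polygon can be cut into triangles, and \<open>\<mu>\<^sub>f\<close> is a simple valuation,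
  \<open>\<mu>\<^sub>f\<close> is polynomial of degree at most \<open>d\<close> iff
  \<open>I g x + I h (x + g) \<equiv> I (g + h) x\<close>
  modulo polynomials of degree at most \<open>d\<close>, for all vectors \<open>g\<close>, \<open>h\<close>
  (\<open>poly_valuation_iff_cocycle\<close>). The rest is algebra with this cocycle relation.

  Suppose that it holds. Normalization gives \<open>I w = 0\<close> for vertical \<open>w\<close>, so taking one of \<open>g\<close>, \<open>h\<close>
  vertical yields property (2), and also \<open>\<Delta>\<^sub>w (I k) \<equiv> 0\<close> for all \<open>k\<close> and all vertical \<open>w\<close>.
  A function that vanishes on one line through the origin and whose differences along another line
  have degree at most \<open>n\<close> has degree at most \<open>n + 1\<close> (\<open>poly_deg_le_Suc_if_complement\<close>).
  By normalization, \<open>I k\<close> vanishes on the horizontal line for horizontal \<open>k\<close>, and every \<open>f\<^sub>L\<close> vanishes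
  on the vertical line; applying the principle to both raises the degree from \<open>d\<close> to \<open>d + 2\<close>,
  which is property (1).

  Conversely, by (2) each \<open>I g\<close> may be replaced by \<open>\<Delta>\<^sub>p F\<close>, where \<open>F = f\<^bsub>L\<^sub>0\<^esub>\<close> and \<open>p\<close> is the horizontal
  component of \<open>g\<close>. As \<open>F\<close> has degree at most \<open>d + 2\<close>, all second differences of \<open>F\<close> are negligible,
  so that \<open>\<Delta>\<^sub>p F\<close> is additive in \<open>p\<close> and insensitive to translations, and the relation follows.

  The geometric input is that every flag valuation is simple. Around the point \<open>a\<close> of a flag
  \<open>(a, L)\<close> there are four infinitely thin sectors, bounded by one of the two rays of \<open>L\<close> and lying on
  one of its two sides. Whether a polygon contains such a sector is a simple valuation of the polygon
  (\<open>germ_indicator_additive\<close>), and the flag valuation is an alternating sum of these four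
  (\<open>Upsilon_eq_germ_combination\<close>).\<close>

section \<open>Polynomial functions on abelian groups\<close>

lemma Delta_add: "Delta a (\<lambda>x. \<phi> x + \<psi> x) = (\<lambda>x. Delta a \<phi> x + Delta a \<psi> x)"
  by (auto simp: Delta_def)

lemma Delta_scale: "Delta a (\<lambda>x. c * \<phi> x) = (\<lambda>x. c * Delta a \<phi> x)"
  by (auto simp: Delta_def algebra_simps)

lemma Delta_shift: "Delta a (\<lambda>x. \<phi> (x + c)) = (\<lambda>x. Delta a \<phi> (x + c))"
  by (auto simp: Delta_def algebra_simps)

lemma Delta_Delta_commute: "Delta a (Delta b \<phi>) = Delta b (Delta a \<phi>)"
  by (auto simp: Delta_def algebra_simps)

lemma Delta_plus: "Delta (a + b) \<phi> x = Delta a \<phi> x + Delta b \<phi> (x + a)"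
  by (simp add: Delta_def algebra_simps)

lemma Delta_0 [simp]: "Delta 0 \<phi> = (\<lambda>x. 0)"
  by (simp add: Delta_def)

lemma poly_deg_le_const [simp]: "poly_deg_le d (\<lambda>x. c)"
  by (induction d arbitrary: c) (auto simp: Delta_def)

lemma poly_deg_le_add:
  "poly_deg_le d \<phi> \<Longrightarrow> poly_deg_le d \<psi> \<Longrightarrow> poly_deg_le d (\<lambda>x. \<phi> x + \<psi> x)"
  by (induction d arbitrary: \<phi> \<psi>) (auto simp: Delta_add)

lemma poly_deg_le_scale: "poly_deg_le d \<phi> \<Longrightarrow> poly_deg_le d (\<lambda>x. c * \<phi> x)"
  by (induction d arbitrary: \<phi>) (auto simp: Delta_scale)

lemma poly_deg_le_uminus: "poly_deg_le d \<phi> \<Longrightarrow> poly_deg_le d (\<lambda>x. - \<phi> x)"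
  using poly_deg_le_scale [of d \<phi> "-1"] by simp

lemma poly_deg_le_diff:
  "poly_deg_le d \<phi> \<Longrightarrow> poly_deg_le d \<psi> \<Longrightarrow> poly_deg_le d (\<lambda>x. \<phi> x - \<psi> x)"
  using poly_deg_le_add [OF _ poly_deg_le_uminus] by fastforce

lemma poly_deg_le_sum:
  "(\<And>i. i \<in> I \<Longrightarrow> poly_deg_le d (\<phi> i)) \<Longrightarrow> poly_deg_le d (\<lambda>x. \<Sum>i\<in>I. \<phi> i x)"
  by (induction I rule: infinite_finite_induct) (auto intro: poly_deg_le_add)

lemma poly_deg_le_shift: "poly_deg_le d \<phi> \<Longrightarrow> poly_deg_le d (\<lambda>x. \<phi> (x + c))"
  by (induction d arbitrary: \<phi>) (auto simp: Delta_shift)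

lemma poly_deg_le_SucI: "poly_deg_le d \<phi> \<Longrightarrow> poly_deg_le (Suc d) \<phi>"
proof (induction d arbitrary: \<phi>)
  case 0
  then obtain c where "\<And>x. \<phi> x = c" by auto
  then have "\<phi> = (\<lambda>x. c)" by auto
  then show ?case by (simp only: poly_deg_le_const)
next
  case (Suc d)
  show ?case
    unfolding poly_deg_le.simps(2) [of "Suc d"] using Suc by simp
qed

text \<open>A function vanishing on \<open>B\<close> is determined by its differences in the directions of \<open>A\<close>, and they
  control its degree. Differences in the directions of \<open>B\<close> still vanish on \<open>B\<close>, and their own
  differences along \<open>A\<close> have degree lowered by one, because differences commute; this drives the
  induction.\<close>

lemma poly_deg_le_Suc_if_complement:
  fixes \<phi> :: "'a::ab_group_add \<Rightarrow> real"
  assumes split: "\<And>x. \<exists>a\<in>A. \<exists>b\<in>B. x = a + b"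
    and B: "\<And>b c. b \<in> B \<Longrightarrow> c \<in> B \<Longrightarrow> b + c \<in> B"
    and A: "\<And>a. a \<in> A \<Longrightarrow> poly_deg_le d (Delta a \<phi>)"
    and zero: "\<And>b. b \<in> B \<Longrightarrow> \<phi> b = 0"
  shows "poly_deg_le (Suc d) \<phi>"
  using A zero
proof (induction d arbitrary: \<phi>)
  case 0
  have Bconst: "Delta b \<phi> = (\<lambda>x. 0)" if b: "b \<in> B" for b
  proof
    fix x
    obtain a c where ac: "a \<in> A" "c \<in> B" "x = c + a" using split by (metis add.commute)
    have "Delta a \<phi> (c + b) = Delta a \<phi> c" using 0(1)[OF ac(1)] by auto
    then show "Delta b \<phi> x = 0" using 0(2) ac b B by (simp add: Delta_def algebra_simps)
  qed
  have "poly_deg_le 0 (Delta x \<phi>)" for x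
  proof -
    obtain a b where ab: "a \<in> A" "b \<in> B" "x = a + b" using split by blast
    then have "Delta x \<phi> = Delta a \<phi>" using Bconst by (auto simp: Delta_plus)
    then show ?thesis using 0(1) ab by simp
  qed
  then show ?case by simp
next
  case (Suc d)
  have Bdir: "poly_deg_le (Suc d) (Delta b \<phi>)" if b: "b \<in> B" for b
  proof (rule Suc.IH)
    show "poly_deg_le d (Delta a (Delta b \<phi>))" if "a \<in> A" for a
      using Suc.prems(1)[OF that] by (simp add: Delta_Delta_commute [of a b])
    show "Delta b \<phi> c = 0" if "c \<in> B" for c
      using Suc.prems(2) B b that by (simp add: Delta_def)
  qed
  have "poly_deg_le (Suc d) (Delta x \<phi>)" for x
  proof -
    obtain a b where ab: "a \<in> A" "b \<in> B" "x = a + b" using split by blast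
    then have "Delta x \<phi> = (\<lambda>y. Delta a \<phi> y + Delta b \<phi> (y + a))"
      by (auto simp: Delta_plus)
    then show ?thesis
      using poly_deg_le_add [OF Suc.prems(1) poly_deg_le_shift [OF Bdir]] ab by simp
  qed
  then show ?case by simp
qed

section \<open>Plane geometry\<close>

definition cross2 :: "real^2 \<Rightarrow> real^2 \<Rightarrow> real" where
  "cross2 u v = u$1 * v$2 - u$2 * v$1"

lemma det_vector_eq_cross2: "det (vector [u, v] :: real^2^2) = cross2 u v"
  by (simp add: det_2 cross2_def)

lemma cross2_add_left: "cross2 (u + v) w = cross2 u w + cross2 v w"
  and cross2_add_right: "cross2 w (u + v) = cross2 w u + cross2 w v"
  and cross2_diff_left: "cross2 (u - v) w = cross2 u w - cross2 v w"
  and cross2_diff_right: "cross2 w (u - v) = cross2 w u - cross2 w v"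
  and cross2_scale_left: "cross2 (c *\<^sub>R u) v = c * cross2 u v"
  and cross2_scale_right: "cross2 u (c *\<^sub>R v) = c * cross2 u v"
  and cross2_uminus_left: "cross2 (- u) v = - cross2 u v"
  and cross2_uminus_right: "cross2 u (- v) = - cross2 u v"
  and cross2_self: "cross2 u u = 0"
  by (simp_all add: cross2_def algebra_simps)

lemmas cross2_simps = cross2_add_left cross2_add_right cross2_diff_left cross2_diff_right
  cross2_scale_left cross2_scale_right cross2_uminus_left cross2_uminus_right cross2_self

text \<open>Cramer's rule in the plane.\<close>

lemma cross2_basis_expansion:
  assumes "cross2 u n \<noteq> 0"
  shows "w = (cross2 w n / cross2 u n) *\<^sub>R u + (cross2 u w / cross2 u n) *\<^sub>R n"
proof -
  have "cross2 u n * w$i = cross2 w n * u$i + cross2 u w * n$i" for i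
    using exhaust_2[of i] by (auto simp: cross2_def algebra_simps)
  then show ?thesis
    using assms by (simp add: vec_eq_iff field_simps)
qed

lemma cross2_eq_0_iff_parallel:
  assumes "u \<noteq> 0"
  shows "cross2 u w = 0 \<longleftrightarrow> (\<exists>t. w = t *\<^sub>R u)"
proof
  assume w: "cross2 u w = 0"
  define n where "n = (vector [- u$2, u$1] :: real^2)"
  have "cross2 u n \<noteq> 0"
    using assms by (auto simp: n_def cross2_def vec_eq_iff forall_2 sum_squares_eq_zero_iff
        power2_eq_square add_nonneg_eq_0_iff)
  from cross2_basis_expansion[OF this, of w] w show "\<exists>t. w = t *\<^sub>R u" by auto
qed (auto simp: cross2_simps)

lemma inner_eq_0_if_cross2:
  fixes c :: "real^2"
  assumes "cross2 u n \<noteq> 0" "c \<bullet> u = 0" "c \<bullet> n = 0"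
  shows "c = 0"
proof -
  have "c \<bullet> c = 0"
    by (subst (2) cross2_basis_expansion[OF assms(1), of c]) (simp add: inner_simps assms)
  then show ?thesis by simp
qed

lemma affine_hull_2_param: "affine hull {a, b} = {a + t *\<^sub>R (b - a) |t. True}"
  for a b :: "'a::real_vector"
  by (auto simp: affine_hull_2_alt)

lemma affine_hull_2_cross2:
  assumes "a \<noteq> b"
  shows "affine hull {a, b} = {x. cross2 (b - a) (x - a) = 0}"
proof -
  have "(\<exists>t. x = a + t *\<^sub>R (b - a)) \<longleftrightarrow> (\<exists>t. x - a = t *\<^sub>R (b - a))" for x
    by (auto simp: algebra_simps)
  then show ?thesis
    using assms by (simp add: affine_hull_2_param cross2_eq_0_iff_parallel)
qed

lemma affine_line_affine_hull_2: "a \<noteq> b \<Longrightarrow> affine_line (affine hull {a, b})"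
  by (simp add: affine_line_def aff_dim_2)

lemma affine_line_eq_affine_hull_2:
  assumes "affine_line L" "a \<in> L" "b \<in> L" "a \<noteq> b"
  shows "L = affine hull {a, b}"
proof (rule affine_dim_equal [symmetric])
  show "affine hull {a, b} \<subseteq> L"
    using assms by (intro hull_minimal) (auto simp: affine_line_def)
  show "aff_dim (affine hull {a, b}) = aff_dim L"
    using assms by (simp add: affine_line_def aff_dim_2)
qed (use assms in \<open>auto simp: affine_line_def\<close>)

lemma affine_lineE:
  assumes "affine_line L" "a \<in> L"
  obtains b where "b \<noteq> a" "L = affine hull {a, b}"
proof -
  have "\<exists>b. b \<in> L \<and> b \<noteq> a"
  proof (rule ccontr)
    assume "\<not> (\<exists>b. b \<in> L \<and> b \<noteq> a)"
    then have "L = {a}" using assms(2) by blast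
    then show False using assms(1) by (simp add: affine_line_def)
  qed
  then obtain b where b: "b \<in> L" "b \<noteq> a" by blast
  show ?thesis
    using that[OF b(2)] affine_line_eq_affine_hull_2[OF assms b(1)] b(2) by blast
qed

lemma collinear_iff_cross2: "collinear {a, b, c} \<longleftrightarrow> cross2 (b - a) (c - a) = 0"
proof (cases "a = b")
  case True
  then show ?thesis by (simp add: cross2_def)
next
  case False
  have "collinear {a, b, c} \<longleftrightarrow> c \<in> affine hull {a, b}"
    by (rule collinear_3_affine_hull[OF False])
  then show ?thesis using False by (simp add: affine_hull_2_cross2)
qed

section \<open>Germs of curves and additivity of flag valuations\<close>

lemma convex_polygon_halfspaces:
  assumes "convex_polygon P"
  obtains I where "finite I" "\<And>c \<beta>. (c, \<beta>) \<in> I \<Longrightarrow> c \<noteq> 0"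
    "P = {x. \<forall>(c, \<beta>)\<in>I. c \<bullet> x \<le> \<beta>}" "interior P = {x. \<forall>(c, \<beta>)\<in>I. c \<bullet> x < \<beta>}"
proof -
  obtain F where F: "finite F" "P = \<Inter>F"
    and "\<forall>h\<in>F. \<exists>c \<beta>. c \<noteq> 0 \<and> h = {x. c \<bullet> x \<le> \<beta>}"
    using assms polytope_imp_polyhedron unfolding convex_polygon_def polyhedron_def by metis
  then obtain c \<beta> where h: "\<And>h. h \<in> F \<Longrightarrow> c h \<noteq> 0 \<and> h = {x. c h \<bullet> x \<le> \<beta> h}"
    by metis
  define I where "I = (\<lambda>h. (c h, \<beta> h)) ` F"
  have P: "P = {x. \<forall>(c, \<beta>)\<in>I. c \<bullet> x \<le> \<beta>}"
    using F(2) h by (auto simp: I_def)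
  have I: "finite I" "\<And>c \<beta>. (c, \<beta>) \<in> I \<Longrightarrow> c \<noteq> 0"
    using F(1) h by (auto simp: I_def)
  have "interior P \<subseteq> {x. c \<bullet> x < \<beta>}" if "(c, \<beta>) \<in> I" for c \<beta>
  proof -
    have "P \<subseteq> {x. c \<bullet> x \<le> \<beta>}" using that P by blast
    then show ?thesis using interior_mono interior_halfspace_le[of c \<beta>] I(2)[OF that] by metis
  qed
  moreover have "{x. \<forall>(c, \<beta>)\<in>I. c \<bullet> x < \<beta>} \<subseteq> interior P"
  proof (rule interior_maximal)
    have "{x. \<forall>(c, \<beta>)\<in>I. c \<bullet> x < \<beta>} = (\<Inter>(c, \<beta>)\<in>I. {x. c \<bullet> x < \<beta>})" by auto
    then show "open {x. \<forall>(c, \<beta>)\<in>I. c \<bullet> x < \<beta>}"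
      using I(1) by (auto intro!: open_INT simp: open_halfspace_lt)
  qed (auto simp: P less_imp_le)
  ultimately have "interior P = {x. \<forall>(c, \<beta>)\<in>I. c \<bullet> x < \<beta>}" by blast
  with I P that show thesis by blast
qed

text \<open>The lexicographic sign of the coefficients is the sign of \<open>p + t * q + t\<^sup>2 * r\<close> for all small
  positive \<open>t\<close>.\<close>

definition lex_neg :: "real \<Rightarrow> real \<Rightarrow> real \<Rightarrow> bool" where
  "lex_neg p q r \<longleftrightarrow> p < 0 \<or> p = 0 \<and> (q < 0 \<or> q = 0 \<and> r < 0)"

lemma lex_neg_uminus: "\<not> lex_neg p q r \<Longrightarrow> \<not> (p = 0 \<and> q = 0 \<and> r = 0) \<Longrightarrow> lex_neg (- p) (- q) (- r)"
  by (auto simp: lex_neg_def)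

lemma eventually_quadratic_neg:
  assumes "lex_neg p q r"
  shows "\<forall>\<^sub>F t in at_right (0::real). p + t * q + t\<^sup>2 * r < 0"
proof -
  have pos: "\<forall>\<^sub>F t in at_right (0::real). t > 0" by (simp add: eventually_at_right_less)
  have lim: "((\<lambda>t. a + t * b + t\<^sup>2 * c) \<longlongrightarrow> a) (at_right 0)" for a b c :: real
    by (rule tendsto_eq_intros refl | simp)+
  consider "p < 0" | "p = 0" "q < 0" | "p = 0" "q = 0" "r < 0"
    using assms by (auto simp: lex_neg_def)
  then show ?thesis
  proof cases
    case 1
    then show ?thesis using order_tendstoD(2)[OF lim] by blast
  next
    case 2
    have "\<forall>\<^sub>F t in at_right (0::real). q + t * r + t\<^sup>2 * 0 < 0"
      using order_tendstoD(2)[OF lim 2(2)] .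
    with pos show ?thesis
    proof eventually_elim
      case (elim t)
      then have "t * (q + t * r) < 0" by (simp add: mult_pos_neg)
      then show ?case using 2 by (simp add: power2_eq_square algebra_simps)
    qed
  next
    case 3
    from pos show ?thesis
      by eventually_elim (use 3 in \<open>simp add: mult_pos_neg\<close>)
  qed
qed

text \<open>For small positive \<open>t\<close> this curve leaves \<open>a\<close> along the ray in direction \<open>v\<close>, bending to the side of
  \<open>w\<close>. If \<open>v\<close> and \<open>w\<close> are independent, it eventually lies inside every sector that
  starts from the ray towards \<open>w\<close>, but it does not stay on any line, so it cannot remain on the boundary
  of a polygon.\<close>

definition germ_curve :: "real^2 \<Rightarrow> real^2 \<Rightarrow> real^2 \<Rightarrow> real \<Rightarrow> real^2" where
  "germ_curve a v w t = a + t *\<^sub>R v + t\<^sup>2 *\<^sub>R w"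

definition germ_indicator :: "real^2 \<Rightarrow> real^2 \<Rightarrow> real^2 \<Rightarrow> (real^2) set \<Rightarrow> real" where
  "germ_indicator a v w P = of_bool (\<forall>\<^sub>F t in at_right 0. germ_curve a v w t \<in> interior P)"

text \<open>On a half-plane the curve restricts to a quadratic polynomial that is not identically zero, and its
  sign near zero is constant.\<close>

lemma germ_halfspaces:
  assumes fin: "finite I" and nz: "\<And>c \<beta>. (c, \<beta>) \<in> I \<Longrightarrow> c \<noteq> 0" and vw: "cross2 v w \<noteq> 0"
    and P: "P = {x. \<forall>(c, \<beta>)\<in>I. c \<bullet> x \<le> \<beta>}" "interior P = {x. \<forall>(c, \<beta>)\<in>I. c \<bullet> x < \<beta>}"
  shows eventually_germ_in_interior_iff:
      "(\<forall>\<^sub>F t in at_right 0. germ_curve a v w t \<in> interior P) \<longleftrightarrow>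
        (\<forall>(c, \<beta>)\<in>I. lex_neg (c \<bullet> a - \<beta>) (c \<bullet> v) (c \<bullet> w))"
    and eventually_germ_dichotomy:
      "(\<forall>\<^sub>F t in at_right 0. germ_curve a v w t \<in> interior P) \<or>
       (\<forall>\<^sub>F t in at_right 0. germ_curve a v w t \<notin> P)"
proof -
  let ?N = "\<forall>(c, \<beta>)\<in>I. lex_neg (c \<bullet> a - \<beta>) (c \<bullet> v) (c \<bullet> w)"
  have ev: "c \<bullet> germ_curve a v w t - \<beta> = (c \<bullet> a - \<beta>) + t * (c \<bullet> v) + t\<^sup>2 * (c \<bullet> w)" for c \<beta> t
    by (simp add: germ_curve_def inner_simps)
  have in_interior: "\<forall>\<^sub>F t in at_right 0. germ_curve a v w t \<in> interior P" if ?N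
  proof -
    have "\<forall>\<^sub>F t in at_right 0. c \<bullet> germ_curve a v w t < \<beta>" if "(c, \<beta>) \<in> I" for c \<beta>
    proof -
      have "lex_neg (c \<bullet> a - \<beta>) (c \<bullet> v) (c \<bullet> w)" using \<open>?N\<close> that by blast
      then have "\<forall>\<^sub>F t in at_right 0. c \<bullet> germ_curve a v w t - \<beta> < 0"
        unfolding ev by (rule eventually_quadratic_neg)
      then show ?thesis by simp
    qed
    then have "\<forall>\<^sub>F t in at_right 0. \<forall>i\<in>I. fst i \<bullet> germ_curve a v w t < snd i"
      using fin by (intro eventually_ball_finite) auto
    then show ?thesis
      by eventually_elim (auto simp: P(2))
  qed
  have outside: "\<forall>\<^sub>F t in at_right 0. germ_curve a v w t \<notin> P" if "\<not> ?N"
  proof -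
    obtain c \<beta> where c: "(c, \<beta>) \<in> I" "\<not> lex_neg (c \<bullet> a - \<beta>) (c \<bullet> v) (c \<bullet> w)"
      using \<open>\<not> ?N\<close> by blast
    have "\<not> (c \<bullet> a - \<beta> = 0 \<and> c \<bullet> v = 0 \<and> c \<bullet> w = 0)"
      using inner_eq_0_if_cross2[OF vw, of c] nz[OF c(1)] by auto
    from eventually_quadratic_neg[OF lex_neg_uminus[OF c(2) this]]
    show ?thesis
    proof eventually_elim
      case (elim t)
      then have "c \<bullet> germ_curve a v w t - \<beta> > 0" unfolding ev by simp
      then show ?case using c(1) unfolding P(1) by force
    qed
  qed
  have not_both: "\<not> ((\<forall>\<^sub>F t in at_right 0. germ_curve a v w t \<in> interior P) \<and>
       (\<forall>\<^sub>F t in at_right 0. germ_curve a v w t \<notin> P))"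
  proof
    assume "(\<forall>\<^sub>F t in at_right 0. germ_curve a v w t \<in> interior P) \<and>
       (\<forall>\<^sub>F t in at_right 0. germ_curve a v w t \<notin> P)"
    then have "\<forall>\<^sub>F t in at_right (0::real). germ_curve a v w t \<in> interior P \<and> germ_curve a v w t \<notin> P"
      by (simp add: eventually_conj_iff)
    then have "\<forall>\<^sub>F t in at_right (0::real). False"
      by eventually_elim (use interior_subset in blast)
    then show False by simp
  qed
  show "(\<forall>\<^sub>F t in at_right 0. germ_curve a v w t \<in> interior P) \<longleftrightarrow> ?N"
  proof (cases ?N)
    case True
    then show ?thesis using in_interior by simp
  next
    case False
    then show ?thesis using outside not_both by argo
  qed
  show "(\<forall>\<^sub>F t in at_right 0. germ_curve a v w t \<in> interior P) \<or>
       (\<forall>\<^sub>F t in at_right 0. germ_curve a v w t \<notin> P)"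
    using in_interior outside by argo
qed

lemma convex_polygon_germ_dichotomy:
  assumes "convex_polygon P" "cross2 v w \<noteq> 0"
  shows "(\<forall>\<^sub>F t in at_right 0. germ_curve a v w t \<in> interior P) \<or>
       (\<forall>\<^sub>F t in at_right 0. germ_curve a v w t \<notin> P)"
proof -
  obtain I where "finite I" "\<And>c \<beta>. (c, \<beta>) \<in> I \<Longrightarrow> c \<noteq> 0"
    "P = {x. \<forall>(c, \<beta>)\<in>I. c \<bullet> x \<le> \<beta>}" "interior P = {x. \<forall>(c, \<beta>)\<in>I. c \<bullet> x < \<beta>}"
    using convex_polygon_halfspaces[OF assms(1)] by blast
  from eventually_germ_dichotomy[OF this(1,2) assms(2) this(3,4)] show ?thesis .
qed

text \<open>The curve is eventually in the interior of at most one piece, because the interiors are disjoint;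
  and if it is eventually in \<open>P\<close>, then it cannot eventually avoid all of the finitely many
  pieces.\<close>

lemma germ_indicator_additive:
  assumes vw: "cross2 v w \<noteq> 0" and P: "convex_polygon P"
    and Q: "finite \<Q>" "\<And>Q. Q \<in> \<Q> \<Longrightarrow> convex_polygon Q" and PQ: "P = \<Union>\<Q>"
    and disj: "pairwise (\<lambda>Q R. interior Q \<inter> interior R = {}) \<Q>"
  shows "germ_indicator a v w P = (\<Sum>Q\<in>\<Q>. germ_indicator a v w Q)"
proof -
  define inside where
    "inside Q \<longleftrightarrow> (\<forall>\<^sub>F t in at_right 0. germ_curve a v w t \<in> interior Q)" for Q
  have outside: "\<forall>\<^sub>F t in at_right 0. germ_curve a v w t \<notin> Q"
    if "convex_polygon Q" "\<not> inside Q" for Q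
    using convex_polygon_germ_dichotomy[OF that(1) vw] that(2) by (auto simp: inside_def)
  have uniq: "Q = R" if "Q \<in> \<Q>" "R \<in> \<Q>" "inside Q" "inside R" for Q R
  proof (rule ccontr)
    assume "Q \<noteq> R"
    then have "interior Q \<inter> interior R = {}" using disj that by (auto simp: pairwise_def)
    moreover have "\<forall>\<^sub>F t in at_right (0::real). germ_curve a v w t \<in> interior Q \<inter> interior R"
      using that(3,4) unfolding inside_def by eventually_elim blast
    ultimately show False by simp
  qed
  show ?thesis
  proof (cases "\<exists>Q\<in>\<Q>. inside Q")
    case True
    then obtain Q where Q1: "Q \<in> \<Q>" "inside Q" by blast
    have "interior Q \<subseteq> interior P" using Q1 PQ by (intro interior_mono) auto
    then have "inside P"
      using Q1(2) unfolding inside_def by (elim eventually_mono) blast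
    moreover have "(\<Sum>R\<in>\<Q>. germ_indicator a v w R) = (\<Sum>R\<in>\<Q>. if R = Q then 1 else 0)"
      using uniq Q1 by (intro sum.cong) (auto simp: germ_indicator_def inside_def)
    ultimately show ?thesis
      using Q(1) Q1(1) by (simp add: germ_indicator_def inside_def)
  next
    case False
    then have "\<forall>\<^sub>F t in at_right 0. \<forall>Q\<in>\<Q>. germ_curve a v w t \<notin> Q"
      using Q outside by (intro eventually_ball_finite) auto
    then have out: "\<forall>\<^sub>F t in at_right 0. germ_curve a v w t \<notin> P"
      by eventually_elim (auto simp: PQ)
    have "\<not> inside P"
    proof
      assume "inside P"
      with out have "\<forall>\<^sub>F t in at_right (0::real). False"
        unfolding inside_def by eventually_elim (use interior_subset in blast)
      then show False by simp
    qed
    then show ?thesis using False by (simp add: germ_indicator_def inside_def)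
  qed
qed

lemma convex_polygon_imp:
  assumes "convex_polygon P"
  shows "convex P" "closed P" "closure (interior P) = P" "aff_dim P = 2" "interior P \<noteq> {}"
proof -
  show c: "convex P" "closed P" "interior P \<noteq> {}"
    using assms polytope_imp_convex polytope_imp_closed by (auto simp: convex_polygon_def)
  show "closure (interior P) = P"
    using c convex_closure_interior closure_closed by metis
  show "aff_dim P = 2"
    using aff_dim_nonempty_interior[OF c(3)] by simp
qed

lemma aff_dim_1_two_points:
  assumes "aff_dim E = 1"
  obtains p q where "p \<in> E" "q \<in> E" "p \<noteq> q"
proof -
  have "E \<noteq> {}" using assms by auto
  then obtain p where p: "p \<in> E" by blast
  have "E \<noteq> {p}" using assms by (auto simp: aff_dim_sing)
  then show thesis using that p by blast
qed

text \<open>Edges are handled below through this description, which does not mention faces. For the converse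
  direction, a line that misses the interior is separated from it by a hyperplane; as the line
  contains two points of \<open>P\<close>, it must be that hyperplane.\<close>

lemma edge_in_line_iff:
  assumes P: "convex_polygon P" and L: "affine_line L"
  shows "(\<exists>E. E edge_of P \<and> E \<subseteq> L) \<longleftrightarrow>
         (\<exists>p q. p \<in> P \<inter> L \<and> q \<in> P \<inter> L \<and> p \<noteq> q) \<and> L \<inter> interior P = {}"
proof (intro iffI conjI)
  assume "\<exists>E. E edge_of P \<and> E \<subseteq> L"
  then obtain E where E: "E face_of P" "aff_dim E = 1" "E \<subseteq> L"
    by (auto simp: edge_of_def)
  then obtain p q where pq: "p \<in> E" "q \<in> E" "p \<noteq> q" using aff_dim_1_two_points by metis
  moreover have EP: "E \<subseteq> P" using E(1) face_of_imp_subset by blast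
  ultimately show "\<exists>p q. p \<in> P \<inter> L \<and> q \<in> P \<inter> L \<and> p \<noteq> q" using E(3) by blast
  have "E exposed_face_of P"
    using E(1) P exposed_face_of_polyhedron polytope_imp_polyhedron
    by (auto simp: convex_polygon_def)
  moreover have "E \<noteq> {}" "E \<noteq> P" using pq(1) E(2) convex_polygon_imp(4)[OF P] by auto
  ultimately obtain c \<beta> where c: "c \<noteq> 0" "P \<subseteq> {x. c \<bullet> x \<le> \<beta>}" "E = P \<inter> {x. c \<bullet> x = \<beta>}"
    unfolding exposed_face_of by blast
  have "L = affine hull {p, q}"
    using affine_line_eq_affine_hull_2[OF L] pq E(3) by blast
  also have "\<dots> \<subseteq> {x. c \<bullet> x = \<beta>}"
    using pq c(3) by (intro hull_minimal) (auto simp: affine_hyperplane)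
  finally have "L \<subseteq> {x. c \<bullet> x = \<beta>}" .
  moreover have "interior P \<subseteq> {x. c \<bullet> x < \<beta>}"
    using interior_mono[OF c(2)] c(1) by simp
  ultimately show "L \<inter> interior P = {}" by fastforce
next
  assume "(\<exists>p q. p \<in> P \<inter> L \<and> q \<in> P \<inter> L \<and> p \<noteq> q) \<and> L \<inter> interior P = {}"
  then obtain p q where pq: "p \<in> P" "p \<in> L" "q \<in> P" "q \<in> L" "p \<noteq> q"
    and disj: "interior P \<inter> L = {}" by blast
  have Leq: "M = affine hull {p, q}" if "affine_line M" "p \<in> M" "q \<in> M" for M
    using affine_line_eq_affine_hull_2[OF that pq(5)] .
  obtain c \<beta> where c: "c \<noteq> 0" "\<And>x. x \<in> interior P \<Longrightarrow> c \<bullet> x \<le> \<beta>" "\<And>x. x \<in> L \<Longrightarrow> c \<bullet> x \<ge> \<beta>"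
  proof -
    have "convex (interior P)" "convex L" "interior P \<noteq> {}" "L \<noteq> {}"
      using convex_polygon_imp[OF P] pq(2) L
      by (auto simp: affine_line_def convex_interior affine_imp_convex)
    from separating_hyperplane_sets[OF this disj] that show thesis by blast
  qed
  have "closure (interior P) \<subseteq> {x. c \<bullet> x \<le> \<beta>}"
    using c(2) by (intro closure_minimal) (auto simp: closed_halfspace_le)
  then have Pc: "c \<bullet> x \<le> \<beta>" if "x \<in> P" for x
    using that convex_polygon_imp(3)[OF P] by blast
  have eq: "c \<bullet> p = \<beta>" "c \<bullet> q = \<beta>"
    by (rule antisym[OF Pc c(3)], (rule pq)+)+
  have "affine_line {x. c \<bullet> x = \<beta>}"
    using c(1) by (simp add: affine_line_def affine_hyperplane)
  then have "{x. c \<bullet> x = \<beta>} = affine hull {p, q}"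
    by (rule Leq) (simp_all add: eq)
  also have "\<dots> = L" by (rule Leq[OF L pq(2,4), symmetric])
  finally have hL: "{x. c \<bullet> x = \<beta>} = L" .
  have "P \<inter> L face_of P"
    unfolding hL[symmetric]
    using face_of_Int_supporting_hyperplane_le[OF convex_polygon_imp(1)[OF P] Pc] by blast
  moreover have "aff_dim (P \<inter> L) = 1"
  proof (rule antisym)
    have "aff_dim (P \<inter> L) \<le> aff_dim L" by (intro aff_dim_subset) auto
    then show "aff_dim (P \<inter> L) \<le> 1" using L by (simp add: affine_line_def)
    have "aff_dim {p, q} \<le> aff_dim (P \<inter> L)" using pq by (intro aff_dim_subset) auto
    then show "1 \<le> aff_dim (P \<inter> L)" using pq(5) by (simp add: aff_dim_2)
  qed
  ultimately show "\<exists>E. E edge_of P \<and> E \<subseteq> L" by (auto simp: edge_of_def)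
qed

text \<open>Near a point \<open>a\<close> of \<open>P\<close>, only the half-planes with \<open>a\<close> on their boundary matter. Their outer normals
  \<open>A\<close> describe the tangent cone of \<open>P\<close> at \<open>a\<close>, and hence the curve germs that enter \<open>P\<close>.\<close>

lemma active_normals:
  assumes P: "convex_polygon P" and a: "a \<in> P"
  obtains A where "0 \<notin> A"
    "\<And>c p. c \<in> A \<Longrightarrow> p \<in> P \<Longrightarrow> c \<bullet> (p - a) \<le> 0"
    "\<And>c p. c \<in> A \<Longrightarrow> p \<in> interior P \<Longrightarrow> c \<bullet> (p - a) < 0"
    "\<And>z. \<forall>c\<in>A. c \<bullet> z \<le> 0 \<Longrightarrow> \<exists>t>0. a + t *\<^sub>R z \<in> P"
    "\<And>z. \<forall>c\<in>A. c \<bullet> z < 0 \<Longrightarrow> \<exists>t>0. a + t *\<^sub>R z \<in> interior P"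
    "\<And>v w. cross2 v w \<noteq> 0 \<Longrightarrow>
      germ_indicator a v w P = of_bool (\<forall>c\<in>A. c \<bullet> v < 0 \<or> c \<bullet> v = 0 \<and> c \<bullet> w < 0)"
proof -
  obtain I where I: "finite I" "\<And>c \<beta>. (c, \<beta>) \<in> I \<Longrightarrow> c \<noteq> 0"
    "P = {x. \<forall>(c, \<beta>)\<in>I. c \<bullet> x \<le> \<beta>}" "interior P = {x. \<forall>(c, \<beta>)\<in>I. c \<bullet> x < \<beta>}"
    using convex_polygon_halfspaces[OF P] by blast
  define A where "A = {c. (c, c \<bullet> a) \<in> I}"
  have near: "\<exists>t>0. (\<forall>(c, \<beta>)\<in>I. c \<bullet> a < \<beta> \<longrightarrow> c \<bullet> (a + t *\<^sub>R z) < \<beta>)" for z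
  proof -
    \<comment> \<open>Inactive constraints survive a small displacement.\<close>
    have "\<forall>\<^sub>F t in at_right 0. c \<bullet> (a + t *\<^sub>R z) < \<beta>" if "c \<bullet> a < \<beta>" for c \<beta>
    proof -
      have "((\<lambda>t. c \<bullet> (a + t *\<^sub>R z)) \<longlongrightarrow> c \<bullet> a) (at_right 0)"
        by (rule tendsto_eq_intros refl | simp)+
      then show ?thesis using order_tendstoD(2) that by blast
    qed
    then have "\<forall>\<^sub>F t in at_right 0. \<forall>i\<in>I. fst i \<bullet> a < snd i \<longrightarrow> fst i \<bullet> (a + t *\<^sub>R z) < snd i"
      using I(1) by (intro eventually_ball_finite) auto
    moreover have "\<forall>\<^sub>F t in at_right (0::real). t > 0" by (simp add: eventually_at_right_less)
    ultimately have "\<forall>\<^sub>F t in at_right 0.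
        t > 0 \<and> (\<forall>i\<in>I. fst i \<bullet> a < snd i \<longrightarrow> fst i \<bullet> (a + t *\<^sub>R z) < snd i)"
      by eventually_elim blast
    then obtain t where "t > 0" "\<forall>i\<in>I. fst i \<bullet> a < snd i \<longrightarrow> fst i \<bullet> (a + t *\<^sub>R z) < snd i"
      using eventually_happens'[of "at_right (0::real)"] by auto
    then show ?thesis by force
  qed
  have aI: "c \<bullet> a \<le> \<beta>" if "(c, \<beta>) \<in> I" for c \<beta> using a that unfolding I(3) by blast
  show thesis
  proof (rule that[of A])
    show "0 \<notin> A" using I(2) by (auto simp: A_def)
    show "c \<bullet> (p - a) \<le> 0" if "c \<in> A" "p \<in> P" for c p
      using that unfolding A_def I(3) by (force simp: inner_diff_right)
    show "c \<bullet> (p - a) < 0" if "c \<in> A" "p \<in> interior P" for c p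
      using that unfolding A_def I(4) by (force simp: inner_diff_right)
    show "\<exists>t>0. a + t *\<^sub>R z \<in> P" if z: "\<forall>c\<in>A. c \<bullet> z \<le> 0" for z
    proof -
      obtain t where t: "t > 0" "\<forall>(c, \<beta>)\<in>I. c \<bullet> a < \<beta> \<longrightarrow> c \<bullet> (a + t *\<^sub>R z) < \<beta>"
        using near by blast
      have "c \<bullet> (a + t *\<^sub>R z) \<le> \<beta>" if c: "(c, \<beta>) \<in> I" for c \<beta>
      proof (cases "c \<bullet> a < \<beta>")
        case True
        then show ?thesis using t(2) c by fastforce
      next
        case False
        then have ca: "c \<bullet> a = \<beta>" using aI[OF c] by simp
        then have "c \<bullet> z \<le> 0" using z c by (auto simp: A_def)
        then show ?thesis using ca t(1) by (simp add: inner_simps mult_le_0_iff)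
      qed
      then show ?thesis using t(1) unfolding I(3) by blast
    qed
    show "\<exists>t>0. a + t *\<^sub>R z \<in> interior P" if z: "\<forall>c\<in>A. c \<bullet> z < 0" for z
    proof -
      obtain t where t: "t > 0" "\<forall>(c, \<beta>)\<in>I. c \<bullet> a < \<beta> \<longrightarrow> c \<bullet> (a + t *\<^sub>R z) < \<beta>"
        using near by blast
      have "c \<bullet> (a + t *\<^sub>R z) < \<beta>" if c: "(c, \<beta>) \<in> I" for c \<beta>
      proof (cases "c \<bullet> a < \<beta>")
        case True
        then show ?thesis using t(2) c by fastforce
      next
        case False
        then have ca: "c \<bullet> a = \<beta>" using aI[OF c] by simp
        then have "c \<bullet> z < 0" using z c by (auto simp: A_def)
        then show ?thesis using ca t(1) by (simp add: inner_simps mult_less_0_iff)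
      qed
      then show ?thesis using t(1) unfolding I(4) by blast
    qed
    show "germ_indicator a v w P = of_bool (\<forall>c\<in>A. c \<bullet> v < 0 \<or> c \<bullet> v = 0 \<and> c \<bullet> w < 0)"
      if vw: "cross2 v w \<noteq> 0" for v w
    proof -
      have "lex_neg (c \<bullet> a - \<beta>) (c \<bullet> v) (c \<bullet> w) \<longleftrightarrow>
          (c \<bullet> a = \<beta> \<longrightarrow> c \<bullet> v < 0 \<or> c \<bullet> v = 0 \<and> c \<bullet> w < 0)" if "(c, \<beta>) \<in> I" for c \<beta>
        using aI[OF that] by (auto simp: lex_neg_def)
      then have "(\<forall>(c, \<beta>)\<in>I. lex_neg (c \<bullet> a - \<beta>) (c \<bullet> v) (c \<bullet> w)) \<longleftrightarrow>
          (\<forall>c\<in>A. c \<bullet> v < 0 \<or> c \<bullet> v = 0 \<and> c \<bullet> w < 0)"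
        by (fastforce simp: A_def)
      then show ?thesis
        using eventually_germ_in_interior_iff[where a = a, OF I(1) _ vw I(3,4)] I(2)
        by (simp add: germ_indicator_def)
    qed
  qed
qed

lemma germ_indicator_outside:
  assumes "convex_polygon P" "a \<notin> P"
  shows "germ_indicator a v w P = 0"
proof -
  have "\<forall>\<^sub>F t in at_right (0::real). germ_curve a v w t \<in> - P"
  proof (rule topological_tendstoD)
    show "(germ_curve a v w \<longlongrightarrow> a) (at_right 0)"
      unfolding germ_curve_def by (rule tendsto_eq_intros refl | simp)+
  qed (use convex_polygon_imp(2)[OF assms(1)] assms(2) in auto)
  moreover have "\<forall>\<^sub>F t in at_right (0::real). False"
    if "\<forall>\<^sub>F t in at_right (0::real). germ_curve a v w t \<in> interior P"
    using calculation that by eventually_elim (use interior_subset in blast)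
  ultimately show ?thesis by (auto simp: germ_indicator_def)
qed

text \<open>The four sectors at \<open>a\<close> along the line spanned by \<open>u\<close>, each with the sign of the rotation from its
  ray into it, relative to the sense of \<open>(u, n)\<close>.\<close>

definition germ_combination :: "real^2 \<Rightarrow> real^2 \<Rightarrow> real^2 \<Rightarrow> (real^2) set \<Rightarrow> real" where
  "germ_combination a u n P =
     germ_indicator a u n P - germ_indicator a (- u) n P
     - germ_indicator a u (- n) P + germ_indicator a (- u) (- n) P"

text \<open>If \<open>a\<close> is a vertex and \<open>L\<close> carries an edge, then exactly one of the four sectors lies in \<open>P\<close>, with
  the right sign. Otherwise the sectors in \<open>P\<close> cancel in pairs: those on both sides of a ray if the ray
  runs into the interior, those along both rays if \<open>L\<close> runs along the
  boundary on both sides of \<open>a\<close>. The proof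
  distinguishes the signs of the active normals on \<open>u\<close>.\<close>

lemma Upsilon_eq_germ_combination:
  assumes s: "s * cross2 u n > 0" and P: "convex_polygon P" and L: "L = affine hull {a, a + u}"
  shows "Upsilon s a L P = germ_combination a u n P"
proof (cases "a \<in> P")
  case False
  then show ?thesis
    using germ_indicator_outside[OF P False]
    by (simp add: germ_combination_def Upsilon_def extreme_point_of_def)
next
  case aP: True
  obtain A where A: "0 \<notin> A"
    "\<And>c p. c \<in> A \<Longrightarrow> p \<in> P \<Longrightarrow> c \<bullet> (p - a) \<le> 0"
    "\<And>c p. c \<in> A \<Longrightarrow> p \<in> interior P \<Longrightarrow> c \<bullet> (p - a) < 0"
    "\<And>z. \<forall>c\<in>A. c \<bullet> z \<le> 0 \<Longrightarrow> \<exists>t>0. a + t *\<^sub>R z \<in> P"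
    "\<And>z. \<forall>c\<in>A. c \<bullet> z < 0 \<Longrightarrow> \<exists>t>0. a + t *\<^sub>R z \<in> interior P"
    "\<And>v w. cross2 v w \<noteq> 0 \<Longrightarrow>
      germ_indicator a v w P = of_bool (\<forall>c\<in>A. c \<bullet> v < 0 \<or> c \<bullet> v = 0 \<and> c \<bullet> w < 0)"
    using active_normals[OF P aP] by blast
  have u0: "u \<noteq> 0" and un: "cross2 u n \<noteq> 0"
    using s by (auto simp: cross2_def)
  have line: "affine_line L" unfolding L using u0 by (intro affine_line_affine_hull_2) simp
  have memL: "x \<in> L \<longleftrightarrow> (\<exists>t. x = a + t *\<^sub>R u)" for x
    by (auto simp: L affine_hull_2_param)
  define H where "H v m = (of_bool (\<forall>c\<in>A. c \<bullet> v < 0 \<or> c \<bullet> v = 0 \<and> c \<bullet> m < 0)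
      - of_bool (\<forall>c\<in>A. c \<bullet> v > 0 \<or> c \<bullet> v = 0 \<and> c \<bullet> m < 0)
      - of_bool (\<forall>c\<in>A. c \<bullet> v < 0 \<or> c \<bullet> v = 0 \<and> c \<bullet> m > 0)
      + of_bool (\<forall>c\<in>A. c \<bullet> v > 0 \<or> c \<bullet> v = 0 \<and> c \<bullet> m > 0) :: real)" for v m
  have H: "germ_combination a u n P = H u n"
    using un by (simp add: germ_combination_def A(6) cross2_simps H_def)
  \<comment> \<open>Reversing both \<open>u\<close> and \<open>n\<close> changes neither side, so unless both rays leave \<open>P\<close> at once, one may
      assume that the ray in direction \<open>v\<close> does not.\<close>
  have one_sided: "Upsilon s a L P = H v m"
    if vm: "s * cross2 v m > 0" and memL: "\<And>x. x \<in> L \<longleftrightarrow> (\<exists>t. x = a + t *\<^sub>R v)"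
      and v: "\<And>c. c \<in> A \<Longrightarrow> c \<bullet> v \<le> 0" for v m
  proof (cases "\<forall>c\<in>A. c \<bullet> v = 0")
    \<comment> \<open>The line is tangent to all active constraints, so \<open>P\<close> extends to both sides of \<open>a\<close>.\<close>
    case all0: True
    obtain t r where tr: "t > 0" "a + t *\<^sub>R v \<in> P" "r > 0" "a + r *\<^sub>R (- v) \<in> P"
      using A(4)[of v] A(4)[of "- v"] all0 by auto
    have v0: "v \<noteq> 0" using vm by (auto simp: cross2_def)
    define q where "q = t / (t + r)"
    have q: "0 < q" "q < 1" using tr by (simp_all add: q_def)
    have "(1 - q) *\<^sub>R (a + t *\<^sub>R v) + q *\<^sub>R (a + r *\<^sub>R (- v)) = a + (t - q * (t + r)) *\<^sub>R v"
      by (simp add: algebra_simps)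
    also have "t - q * (t + r) = 0" using tr by (simp add: q_def)
    finally have "a = (1 - q) *\<^sub>R (a + t *\<^sub>R v) + q *\<^sub>R (a + r *\<^sub>R (- v))" by simp
    moreover have "a + t *\<^sub>R v \<noteq> a + r *\<^sub>R (- v)"
    proof
      assume "a + t *\<^sub>R v = a + r *\<^sub>R (- v)"
      then have "(t + r) *\<^sub>R v = 0" by (simp add: algebra_simps)
      then show False using tr v0 by simp
    qed
    ultimately have "a \<in> open_segment (a + t *\<^sub>R v) (a + r *\<^sub>R (- v))"
      using q unfolding in_segment by blast
    then have "\<not> a extreme_point_of P"
      using tr unfolding extreme_point_of_def by blast
    moreover have "H v m = 0" using all0 by (simp add: H_def)
    ultimately show ?thesis by (simp add: Upsilon_def)
  next
    case False
    then obtain c0 where c0: "c0 \<in> A" "c0 \<bullet> v < 0" using v by force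
    show ?thesis
    proof (cases "\<exists>k\<in>A. k \<bullet> v = 0")
      case False
      \<comment> \<open>The ray in direction \<open>v\<close> runs into the interior.\<close>
      then have neg: "\<forall>c\<in>A. c \<bullet> v < 0" using v by force
      then obtain t where "a + t *\<^sub>R v \<in> interior P" using A(5) by blast
      then have "L \<inter> interior P \<noteq> {}" using memL by blast
      then have "Upsilon s a L P = 0"
        using edge_in_line_iff[OF P line] by (simp add: Upsilon_def)
      moreover have "H v m = 0" using neg c0 by (force simp: H_def)
      ultimately show ?thesis by simp
    next
      case True
      \<comment> \<open>The constraint \<open>k\<close> makes the ray a part of the boundary, and \<open>c0\<close> makes \<open>a\<close> an end of it.\<close>
      then obtain k where k: "k \<in> A" "k \<bullet> v = 0" by blast
      have cvm: "cross2 v m \<noteq> 0" using vm by auto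
      have km: "k \<bullet> m \<noteq> 0" using inner_eq_0_if_cross2[OF cvm k(2)] k(1) A(1) by auto
      have side: "cross2 v (p - a) / cross2 v m * (c \<bullet> m) < 0"
        if "c \<in> A" "c \<bullet> v = 0" "p \<in> interior P" for c p
      proof -
        have "c \<bullet> (p - a) = cross2 v (p - a) / cross2 v m * (c \<bullet> m)"
          by (subst cross2_basis_expansion[OF cvm, of "p - a"]) (simp add: inner_simps that(2))
        then show ?thesis using A(3)[OF that(1,3)] by simp
      qed
      \<comment> \<open>All active constraints along \<open>L\<close> have the interior, and in particular \<open>p0\<close>, on the same side.\<close>
      obtain p0 where p0: "p0 \<in> interior P" using convex_polygon_imp(5)[OF P] by blast
      have same: "c \<bullet> m < 0 \<longleftrightarrow> k \<bullet> m < 0" "c \<bullet> m > 0 \<longleftrightarrow> k \<bullet> m > 0"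
        if "c \<in> A" "c \<bullet> v = 0" for c
      proof -
        define y where "y = cross2 v (p0 - a) / cross2 v m"
        have "y * (c \<bullet> m) < 0" "y * (k \<bullet> m) < 0"
          using side[OF that p0] side[OF k p0] by (simp_all add: y_def)
        then show "c \<bullet> m < 0 \<longleftrightarrow> k \<bullet> m < 0" "c \<bullet> m > 0 \<longleftrightarrow> k \<bullet> m > 0"
          by (auto simp: mult_less_0_iff)
      qed
      have Hval: "H v m = (if k \<bullet> m < 0 then 1 else - 1)"
      proof -
        have all: "(\<forall>c\<in>A. c \<bullet> v < 0 \<or> c \<bullet> v = 0 \<and> Q c) \<longleftrightarrow> Q k"
          if "\<And>c. c \<in> A \<Longrightarrow> c \<bullet> v = 0 \<Longrightarrow> Q c \<longleftrightarrow> Q k" for Q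
        proof (intro iffI ballI)
          assume "\<forall>c\<in>A. c \<bullet> v < 0 \<or> c \<bullet> v = 0 \<and> Q c"
          with k show "Q k" by auto
        next
          fix c assume "Q k" "c \<in> A"
          then show "c \<bullet> v < 0 \<or> c \<bullet> v = 0 \<and> Q c"
            using v[of c] that[of c] by linarith
        qed
        have forward: "(\<forall>c\<in>A. c \<bullet> v < 0 \<or> c \<bullet> v = 0 \<and> c \<bullet> m < 0) \<longleftrightarrow> k \<bullet> m < 0"
          "(\<forall>c\<in>A. c \<bullet> v < 0 \<or> c \<bullet> v = 0 \<and> c \<bullet> m > 0) \<longleftrightarrow> k \<bullet> m > 0"
          by (rule all, rule same, assumption+)+
        have backward: "(\<forall>c\<in>A. c \<bullet> v > 0 \<or> c \<bullet> v = 0 \<and> c \<bullet> m < 0) = False"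
          "(\<forall>c\<in>A. c \<bullet> v > 0 \<or> c \<bullet> v = 0 \<and> c \<bullet> m > 0) = False"
          using c0 by force+
        show ?thesis unfolding H_def forward backward using km by simp
      qed
      have orient: "s * cross2 v (p - a) > 0 \<longleftrightarrow> k \<bullet> m < 0" if "p \<in> interior P" for p
      proof -
        define y where "y = cross2 v (p - a) / cross2 v m"
        have "y * (k \<bullet> m) < 0" using side[OF k that] by (simp add: y_def)
        moreover have "s * cross2 v (p - a) = y * (s * cross2 v m)" using cvm by (simp add: y_def)
        ultimately show ?thesis using vm by (auto simp: mult_less_0_iff zero_less_mult_iff)
      qed
      have ray: "\<exists>t\<ge>0. x = a + t *\<^sub>R v" if x: "x \<in> P" "x \<in> L" for x
      proof -
        obtain t where t: "x = a + t *\<^sub>R v" using memL x(2) by blast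
        have "t * (c0 \<bullet> v) \<le> 0" using A(2)[OF c0(1) x(1)] t by simp
        then show ?thesis using t c0(2) by (auto simp: mult_le_0_iff)
      qed
      have kL: "k \<bullet> (x - a) = 0 \<longleftrightarrow> x \<in> L" for x
      proof
        assume *: "k \<bullet> (x - a) = 0"
        have "cross2 v (x - a) / cross2 v m * (k \<bullet> m) = k \<bullet> (x - a)"
          by (subst (2) cross2_basis_expansion[OF cvm, of "x - a"]) (simp add: inner_simps k(2))
        then have "cross2 v (x - a) = 0" using * km cvm by simp
        then have "x - a = (cross2 (x - a) m / cross2 v m) *\<^sub>R v"
          using cross2_basis_expansion[OF cvm, of "x - a"] by simp
        then show "x \<in> L" unfolding memL by (metis add.commute diff_add_cancel)
      qed (auto simp: memL k(2))
      have ext: "a extreme_point_of P"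
        unfolding extreme_point_of_def
      proof (intro conjI ballI notI)
        fix x y assume xy: "x \<in> P" "y \<in> P" "a \<in> open_segment x y"
        then obtain q where q: "x \<noteq> y" "0 < q" "q < 1" "a = (1 - q) *\<^sub>R x + q *\<^sub>R y"
          by (auto simp: in_segment)
        have comb: "(1 - q) * (c \<bullet> (x - a)) + q * (c \<bullet> (y - a)) = 0" for c
        proof -
          have "(1 - q) *\<^sub>R (x - a) + q *\<^sub>R (y - a) = ((1 - q) *\<^sub>R x + q *\<^sub>R y) - a"
            by (simp add: algebra_simps)
          also have "\<dots> = 0" using q(4) by simp
          finally have "c \<bullet> ((1 - q) *\<^sub>R (x - a) + q *\<^sub>R (y - a)) = 0" by simp
          then show ?thesis by (simp add: inner_add_right)
        qed
        have vanish: "c \<bullet> (x - a) = 0 \<and> c \<bullet> (y - a) = 0" if "c \<in> A" for c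
        proof -
          have "(1 - q) * (c \<bullet> (x - a)) \<le> 0" "q * (c \<bullet> (y - a)) \<le> 0"
            using A(2)[OF that] xy q by (simp_all add: mult_nonneg_nonpos)
          with comb[of c] have "(1 - q) * (c \<bullet> (x - a)) = 0" "q * (c \<bullet> (y - a)) = 0"
            by linarith+
          then show ?thesis using q by simp
        qed
        obtain t r where "x = a + t *\<^sub>R v" "y = a + r *\<^sub>R v"
          using vanish[OF k(1)] kL memL by meson
        with vanish[OF c0(1)] c0(2) have "x = a" "y = a" by auto
        with q(1) show False by simp
      qed (rule aP)
      obtain t where t: "t > 0" "a + t *\<^sub>R v \<in> P" using A(4) v by blast
      have v0: "v \<noteq> 0" using vm by (auto simp: cross2_def)
      have b: "a + t *\<^sub>R v \<in> P \<inter> L - {a}" using t v0 memL by auto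
      have "x \<notin> interior P" if "x \<in> L" for x
        using A(3)[OF k(1), of x] kL[of x] that by auto
      then have "L \<inter> interior P = {}" by blast
      moreover have "a \<in> L" by (simp add: L hull_inc)
      ultimately have edge: "\<exists>E. E edge_of P \<and> E \<subseteq> L"
        unfolding edge_in_line_iff[OF P line] using b aP by blast
      have "positive_basis s (x - a) (p - a) \<longleftrightarrow> k \<bullet> m < 0"
        if x: "x \<in> P \<inter> L - {a}" and p: "p \<in> interior P" for x p
      proof -
        obtain r where r: "r \<ge> 0" "x = a + r *\<^sub>R v" using ray x by blast
        with x have "r > 0" by (cases "r = 0") auto
        have "s * cross2 (x - a) (p - a) = r * (s * cross2 v (p - a))"
          by (simp add: r(2) cross2_scale_left)
        then have "s * cross2 (x - a) (p - a) > 0 \<longleftrightarrow> s * cross2 v (p - a) > 0"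
          using \<open>r > 0\<close> by (metis zero_less_mult_pos mult_pos_pos)
        then show ?thesis using orient[OF p]
          by (simp add: positive_basis_def det_vector_eq_cross2)
      qed
      then have "(\<forall>x\<in>P \<inter> L - {a}. \<forall>p\<in>interior P. positive_basis s (x - a) (p - a)) \<longleftrightarrow> k \<bullet> m < 0"
        using b p0 by blast
      then show ?thesis using ext edge Hval by (simp add: Upsilon_def)
    qed
  qed
  show ?thesis
  proof (cases "(\<exists>c\<in>A. c \<bullet> u > 0) \<and> (\<exists>c\<in>A. c \<bullet> u < 0)")
    case True
    \<comment> \<open>Both rays leave \<open>P\<close>, so that \<open>L\<close> touches \<open>P\<close> in \<open>a\<close> only.\<close>
    then obtain c1 c2 where c: "c1 \<in> A" "c1 \<bullet> u > 0" "c2 \<in> A" "c2 \<bullet> u < 0" by blast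
    have "x = a" if x: "x \<in> P \<inter> L" for x
    proof -
      obtain t where t: "x = a + t *\<^sub>R u" using memL x by blast
      have "t * (c1 \<bullet> u) \<le> 0" "t * (c2 \<bullet> u) \<le> 0"
        using A(2)[OF c(1), of x] A(2)[OF c(3), of x] x by (auto simp: t)
      then show ?thesis using c t by (auto simp: mult_le_0_iff)
    qed
    then have "\<not> (\<exists>p q. p \<in> P \<inter> L \<and> q \<in> P \<inter> L \<and> p \<noteq> q)" by metis
    then have ups: "Upsilon s a L P = 0"
      unfolding Upsilon_def edge_in_line_iff[OF P line] by simp
    have "\<not> (\<forall>c\<in>A. c \<bullet> u < 0 \<or> c \<bullet> u = 0 \<and> Q c)" for Q
      by (rule notI, drule bspec[OF _ c(1)]) (use c(2) in auto)
    moreover have "\<not> (\<forall>c\<in>A. c \<bullet> u > 0 \<or> c \<bullet> u = 0 \<and> Q c)" for Q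
      by (rule notI, drule bspec[OF _ c(3)]) (use c(4) in auto)
    ultimately have "H u n = 0" unfolding H_def by (simp only: of_bool_def if_False)
    with ups show ?thesis using H by simp
  next
    case False
    then consider "\<And>c. c \<in> A \<Longrightarrow> c \<bullet> u \<le> 0" | "\<And>c. c \<in> A \<Longrightarrow> c \<bullet> (- u) \<le> 0"
      by (force simp: not_less)
    then show ?thesis
    proof cases
      case 1
      then show ?thesis using one_sided[OF s memL] H by simp
    next
      case 2
      have "s * cross2 (- u) (- n) > 0" using s by (simp add: cross2_simps)
      moreover have "x \<in> L \<longleftrightarrow> (\<exists>t. x = a + t *\<^sub>R (- u))" for x
        unfolding memL by (metis minus_minus scaleR_minus_left scaleR_minus_right)
      ultimately have "Upsilon s a L P = H (- u) (- n)" using one_sided 2 by blast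
      also have "\<dots> = H u n" by (simp add: H_def)
      finally show ?thesis using H by simp
    qed
  qed
qed

lemma finite_Upsilon_support:
  assumes "convex_polygon P"
  shows "finite {(a, L). (a, L) \<in> flags \<and> Upsilon s a L P \<noteq> 0}"
proof (rule finite_subset)
  let ?V = "{a. a extreme_point_of P}" and ?E = "{E. E face_of P}"
  have poly: "polytope P" using assms by (simp add: convex_polygon_def)
  show "finite (?V \<times> (\<lambda>E. affine hull E) ` ?E)"
    using finite_polyhedron_extreme_points[OF polytope_imp_polyhedron[OF poly]]
      finite_polytope_faces[OF poly] by simp
  show "{(a, L). (a, L) \<in> flags \<and> Upsilon s a L P \<noteq> 0} \<subseteq> ?V \<times> (\<lambda>E. affine hull E) ` ?E"
  proof
    fix x assume "x \<in> {(a, L). (a, L) \<in> flags \<and> Upsilon s a L P \<noteq> 0}"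
    then obtain a L where *: "x = (a, L)" "(a, L) \<in> flags" "Upsilon s a L P \<noteq> 0" by auto
    then obtain E where E: "a extreme_point_of P" "E face_of P" "aff_dim E = 1" "E \<subseteq> L"
      by (auto simp: Upsilon_def edge_of_def split: if_splits)
    have line: "affine_line L" using * by (simp add: flags_def)
    have "affine hull E = L"
      using E(3,4) line aff_dim_eq_full_gen[OF E(4)] by (simp add: affine_line_def hull_same)
    then show "x \<in> ?V \<times> (\<lambda>E. affine hull E) ` ?E" using E *(1) by blast
  qed
qed

lemma Upsilon_additive:
  assumes s: "s \<noteq> 0" and flag: "(a, L) \<in> flags"
    and P: "convex_polygon P"
    and Q: "finite \<Q>" "\<And>Q. Q \<in> \<Q> \<Longrightarrow> convex_polygon Q" and PQ: "P = \<Union>\<Q>"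
    and disj: "pairwise (\<lambda>Q R. interior Q \<inter> interior R = {}) \<Q>"
  shows "Upsilon s a L P = (\<Sum>Q\<in>\<Q>. Upsilon s a L Q)"
proof -
  obtain b where b: "b \<noteq> a" "L = affine hull {a, b}"
    using flag affine_lineE unfolding flags_def by blast
  define u where "u = b - a"
  \<comment> \<open>Rotating \<open>u\<close> by a right angle in the sense of \<open>s\<close> gives a normal on the positive side.\<close>
  define n where "n = s *\<^sub>R (vector [- u$2, u$1] :: real^2)"
  have "u \<noteq> 0" using b by (simp add: u_def)
  then have "u$1 \<noteq> 0 \<or> u$2 \<noteq> 0" by (auto simp: vec_eq_iff forall_2)
  then have "(u$1)\<^sup>2 + (u$2)\<^sup>2 > 0" by (simp add: sum_power2_gt_zero_iff)
  moreover have "s * cross2 u n = s\<^sup>2 * ((u$1)\<^sup>2 + (u$2)\<^sup>2)"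
    by (simp add: cross2_def n_def power2_eq_square algebra_simps)
  ultimately have sun: "s * cross2 u n > 0" using s by simp
  then have un: "cross2 u n \<noteq> 0" by auto
  have Ups: "Upsilon s a L R = germ_combination a u n R" if "convex_polygon R" for R
    by (rule Upsilon_eq_germ_combination[OF sun that]) (simp add: b(2) u_def)
  have add: "germ_indicator a v w P = (\<Sum>Q\<in>\<Q>. germ_indicator a v w Q)"
    if "cross2 v w \<noteq> 0" for v w
    by (rule germ_indicator_additive[OF that P Q PQ disj])
  have "germ_combination a u n P = (\<Sum>Q\<in>\<Q>. germ_combination a u n Q)"
    using un unfolding germ_combination_def
    by (simp add: add cross2_simps sum_subtractf sum.distrib)
  also have "\<dots> = (\<Sum>Q\<in>\<Q>. Upsilon s a L Q)" using Q Ups by (intro sum.cong) auto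
  finally show ?thesis using Ups[OF P] by simp
qed

theorem simple_valuation_flag_valuation:
  assumes "s \<noteq> 0"
  shows "simple_valuation (flag_valuation s f)"
  unfolding simple_valuation_def
proof (intro allI impI, elim conjE)
  fix P :: "(real^2) set" and \<Q>
  assume P: "convex_polygon P" and Q: "finite \<Q>" "\<forall>Q\<in>\<Q>. convex_polygon Q" "P = \<Union>\<Q>"
    "pairwise (\<lambda>Q R. interior Q \<inter> interior R = {}) \<Q>"
  define supp where "supp R = {(a, L). (a, L) \<in> flags \<and> Upsilon s a L R \<noteq> 0}" for R
  \<comment> \<open>A common finite index set for all the sums, to exchange summations.\<close>
  define X where "X = supp P \<union> (\<Union>Q\<in>\<Q>. supp Q)"
  have fin: "finite X"
    using finite_Upsilon_support P Q by (auto simp: X_def supp_def)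
  have val: "flag_valuation s f R = (\<Sum>(a, L)\<in>X. f a L * Upsilon s a L R)" if "supp R \<subseteq> X" for R
    unfolding flag_valuation_def
    using fin that by (intro sum.mono_neutral_left) (auto simp: X_def supp_def)
  have "flag_valuation s f P = (\<Sum>(a, L)\<in>X. f a L * Upsilon s a L P)"
    by (rule val) (simp add: X_def)
  also have "\<dots> = (\<Sum>(a, L)\<in>X. \<Sum>Q\<in>\<Q>. f a L * Upsilon s a L Q)"
  proof (intro sum.cong refl, clarify)
    fix a L assume "(a, L) \<in> X"
    then have "(a, L) \<in> flags" by (auto simp: X_def supp_def)
    from Upsilon_additive[OF assms this P Q(1) _ Q(3,4)] Q(2)
    show "f a L * Upsilon s a L P = (\<Sum>Q\<in>\<Q>. f a L * Upsilon s a L Q)"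
      by (simp add: sum_distrib_left)
  qed
  also have "\<dots> = (\<Sum>Q\<in>\<Q>. \<Sum>(a, L)\<in>X. f a L * Upsilon s a L Q)"
    unfolding case_prod_unfold by (rule sum.swap)
  also have "\<dots> = (\<Sum>Q\<in>\<Q>. flag_valuation s f Q)"
    by (intro sum.cong refl val [symmetric]) (auto simp: X_def)
  finally show "flag_valuation s f P = (\<Sum>Q\<in>\<Q>. flag_valuation s f Q)" .
qed

section \<open>Triangles\<close>

definition edge_increment :: "(real^2 \<Rightarrow> (real^2) set \<Rightarrow> real) \<Rightarrow> real^2 \<Rightarrow> real^2 \<Rightarrow> real" where
  "edge_increment f a b = f b (affine hull {a, b}) - f a (affine hull {a, b})"

lemma convex_polygon_triangle:
  assumes "cross2 (b - a) (c - a) \<noteq> 0"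
  shows "convex_polygon (convex hull {a, b, c})"
proof -
  have "\<not> collinear {a, b, c}" using assms by (simp add: collinear_iff_cross2)
  then have int: "interior (convex hull {a, b, c}) =
      {v. \<exists>x y z. 0 < x \<and> 0 < y \<and> 0 < z \<and> x + y + z = 1 \<and> x *\<^sub>R a + y *\<^sub>R b + z *\<^sub>R c = v}"
    by (rule interior_convex_hull_3_minimal) simp
  have "(1/3) *\<^sub>R a + (1/3) *\<^sub>R b + (1/3) *\<^sub>R c \<in> interior (convex hull {a, b, c})"
    unfolding int mem_Collect_eq by (intro exI conjI refl) simp_all
  then show ?thesis by (auto simp: convex_polygon_def polytope_convex_hull)
qed

lemma affine_independent_triangle:
  assumes "cross2 (b - a) (c - a) \<noteq> 0"
  shows "\<not> affine_dependent {a, b, c}" "a \<noteq> b" "a \<noteq> c" "b \<noteq> c"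
  using assms collinear_3_eq_affine_dependent[of a b c]
  unfolding collinear_iff_cross2 [symmetric] by auto

text \<open>The other five flags of the triangle are obtained by permuting the vertices; an odd permutation
  changes the sign of \<^const>\<open>cross2\<close>.\<close>

lemma Upsilon_triangle:
  assumes nz: "cross2 (b - a) (c - a) \<noteq> 0" and s: "s \<noteq> 0"
  shows "Upsilon s a (affine hull {a, b}) (convex hull {a, b, c}) = sgn (s * cross2 (b - a) (c - a))"
proof -
  let ?L = "affine hull {a, b}" and ?P = "convex hull {a, b, c}" and ?D = "cross2 (b - a) (c - a)"
  note indep = affine_independent_triangle[OF nz]
  have ext: "a extreme_point_of ?P"
    using extreme_point_of_convex_hull_affine_independent[OF indep(1)] by simp
  have "convex hull {a, b} face_of ?P"
    unfolding face_of_convex_hull_affine_independent[OF indep(1)]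
    by (intro exI[of _ "{a, b}"]) simp
  moreover have "aff_dim (convex hull {a, b}) = 1"
    using indep(2) by (simp add: aff_dim_convex_hull aff_dim_2)
  ultimately have edge: "\<exists>E. E edge_of ?P \<and> E \<subseteq> ?L"
    unfolding edge_of_def using convex_hull_subset_affine_hull[of "{a, b}"] by blast
  have ray: "\<exists>t>0. x - a = t *\<^sub>R (b - a)" if x: "x \<in> ?P \<inter> ?L - {a}" for x
  proof -
    have "x \<in> ?P" using x by blast
    then obtain u v w where uvw: "0 \<le> u" "0 \<le> v" "0 \<le> w" "u + v + w = 1" "x = u *\<^sub>R a + v *\<^sub>R b + w *\<^sub>R c"
      unfolding convex_hull_3 by blast
    have xa: "x - a = v *\<^sub>R (b - a) + w *\<^sub>R (c - a)"
    proof -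
      have u: "u = 1 - v - w" using uvw(4) by simp
      show ?thesis unfolding uvw(5) u by (simp add: algebra_simps)
    qed
    have "cross2 (b - a) (x - a) = 0" using x affine_hull_2_cross2[OF indep(2)] by blast
    then have "w = 0" unfolding xa using nz by (simp only: cross2_simps) simp
    then have "x - a = v *\<^sub>R (b - a)" using xa by simp
    moreover have "v \<noteq> 0" using calculation x by auto
    ultimately show ?thesis using uvw(2) by (auto intro!: exI[of _ v])
  qed
  have above: "\<exists>z>0. cross2 (b - a) (p - a) = z * ?D" if p: "p \<in> interior ?P" for p
  proof -
    have "\<not> collinear {a, b, c}" using nz by (simp add: collinear_iff_cross2)
    then have "interior ?P =
        {v. \<exists>x y z. 0 < x \<and> 0 < y \<and> 0 < z \<and> x + y + z = 1 \<and> x *\<^sub>R a + y *\<^sub>R b + z *\<^sub>R c = v}"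
      by (rule interior_convex_hull_3_minimal) simp
    then obtain x y z where xyz: "0 < z" "x + y + z = 1" "p = x *\<^sub>R a + y *\<^sub>R b + z *\<^sub>R c"
      using p by auto
    have "p - a = y *\<^sub>R (b - a) + z *\<^sub>R (c - a)"
    proof -
      have x: "x = 1 - y - z" using xyz(2) by simp
      show ?thesis unfolding xyz(3) x by (simp add: algebra_simps)
    qed
    then show ?thesis using xyz(1) by (auto simp: cross2_add_right cross2_scale_right cross2_self)
  qed
  have pos: "positive_basis s (x - a) (p - a) \<longleftrightarrow> s * ?D > 0"
    if x: "x \<in> ?P \<inter> ?L - {a}" and p: "p \<in> interior ?P" for x p
  proof -
    obtain t where t: "t > 0" "x - a = t *\<^sub>R (b - a)" using ray[OF x] by blast
    obtain z where z: "z > 0" "cross2 (b - a) (p - a) = z * ?D" using above[OF p] by blast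
    have "s * cross2 (x - a) (p - a) = (t * z) * (s * ?D)"
      unfolding t(2) cross2_scale_left z(2) by simp
    moreover have "t * z > 0" using t z by simp
    ultimately show ?thesis
      unfolding positive_basis_def det_vector_eq_cross2 by (metis zero_less_mult_pos mult_pos_pos)
  qed
  have "b \<in> ?P \<inter> ?L - {a}" using indep(2) by (auto intro: hull_inc)
  moreover have "interior ?P \<noteq> {}" using convex_polygon_triangle[OF nz] by (simp add: convex_polygon_def)
  ultimately have "(\<forall>x\<in>?P \<inter> ?L - {a}. \<forall>p\<in>interior ?P. positive_basis s (x - a) (p - a)) \<longleftrightarrow> s * ?D > 0"
    using pos by blast
  then have "Upsilon s a ?L ?P = (if s * ?D > 0 then 1 else -1)"
    using ext edge by (simp add: Upsilon_def)
  also have "\<dots> = sgn (s * ?D)"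
  proof -
    have "s * ?D \<noteq> 0" using nz s by simp
    then show ?thesis by (simp only: sgn_if) (simp add: not_less)
  qed
  finally show ?thesis .
qed

lemma Upsilon_triangle_support:
  assumes nz: "cross2 (b - a) (c - a) \<noteq> 0" and s: "s \<noteq> 0"
  shows "{(p, L). (p, L) \<in> flags \<and> Upsilon s p L (convex hull {a, b, c}) \<noteq> 0} =
    {(a, affine hull {a, b}), (b, affine hull {a, b}), (b, affine hull {b, c}), (c, affine hull {b, c}),
     (c, affine hull {c, a}), (a, affine hull {c, a})}" (is "?S = ?R")
proof (rule antisym)
  note indep = affine_independent_triangle[OF nz]
  have nz': "cross2 (c - b) (a - b) \<noteq> 0" "cross2 (a - c) (b - c) \<noteq> 0"
    "cross2 (a - b) (c - b) \<noteq> 0" "cross2 (b - c) (a - c) \<noteq> 0" "cross2 (c - a) (b - a) \<noteq> 0"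
    using nz by (simp_all add: cross2_def algebra_simps)
  show "?S \<subseteq> ?R"
  proof
    fix x assume "x \<in> ?S"
    then obtain p L where x: "x = (p, L)" and flag: "affine_line L" "p \<in> L"
      and U: "Upsilon s p L (convex hull {a, b, c}) \<noteq> 0" by (auto simp: flags_def)
    from U obtain E where E: "p extreme_point_of (convex hull {a, b, c})"
      "E face_of (convex hull {a, b, c})" "aff_dim E = 1" "E \<subseteq> L"
      by (auto simp: Upsilon_def edge_of_def split: if_splits)
    have p: "p \<in> {a, b, c}"
      using E(1) extreme_point_of_convex_hull_affine_independent[OF indep(1)] by blast
    obtain C where C: "C \<subseteq> {a, b, c}" "E = convex hull C"
      using E(2) face_of_convex_hull_affine_independent[OF indep(1)] by blast
    have "aff_dim C = 1" using E(3) C(2) by (simp add: aff_dim_convex_hull)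
    then obtain q r where qr: "q \<in> C" "r \<in> C" "q \<noteq> r" by (rule aff_dim_1_two_points)
    have "q \<in> L" "r \<in> L" using qr C(2) E(4) hull_inc by fast+
    then have L: "L = affine hull {q, r}" using affine_line_eq_affine_hull_2[OF flag(1) _ _ qr(3)] by blast
    have "q \<in> {a, b, c}" "r \<in> {a, b, c}" using qr C(1) by blast+
    with qr(3) have "{q, r} = {a, b} \<or> {q, r} = {b, c} \<or> {q, r} = {c, a}"
      by (elim insertE emptyE) (simp_all add: insert_commute)
    then have "L = affine hull {a, b} \<or> L = affine hull {b, c} \<or> L = affine hull {c, a}"
      using L by metis
    moreover have "c \<notin> affine hull {a, b}" "a \<notin> affine hull {b, c}" "b \<notin> affine hull {c, a}"
      using indep nz nz' by (simp_all add: affine_hull_2_cross2)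
    ultimately show "x \<in> ?R" using p flag(2) x by blast
  qed
  have flag: "(p, affine hull {p, q}) \<in> flags" "(q, affine hull {p, q}) \<in> flags" if "p \<noteq> q" for p q
    using that by (auto simp: flags_def affine_line_affine_hull_2 hull_inc)
  have ne: "Upsilon s p (affine hull {p, q}) (convex hull {p, q, r}) \<noteq> 0"
    if "cross2 (q - p) (r - p) \<noteq> 0" for p q r
    using Upsilon_triangle[OF that s] that s by (simp add: sgn_zero_iff)
  show "?R \<subseteq> ?S"
    using indep(2-4) flag[of a b] flag[of b c] flag[of c a]
      ne[OF nz] ne[OF nz'(1)] ne[OF nz'(2)] ne[OF nz'(3)] ne[OF nz'(4)] ne[OF nz'(5)]
    by (simp add: insert_commute)
qed

text \<open>Along each edge, traversed in the order \<open>a\<close>, \<open>b\<close>, \<open>c\<close>, \<open>a\<close>, the two flags have opposite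
  signs, so an edge contributes an increment of \<open>f\<close>.\<close>

lemma flag_valuation_triangle:
  assumes nz: "cross2 (b - a) (c - a) \<noteq> 0" and s: "s \<noteq> 0"
  shows "flag_valuation s f (convex hull {a, b, c}) = - sgn (s * cross2 (b - a) (c - a)) *
    (edge_increment f a b + edge_increment f b c + edge_increment f c a)"
proof -
  let ?e = "sgn (s * cross2 (b - a) (c - a))" and ?P = "convex hull {a, b, c}"
  note indep = affine_independent_triangle[OF nz]
  have cyc: "cross2 (c - b) (a - b) = cross2 (b - a) (c - a)"
    "cross2 (a - c) (b - c) = cross2 (b - a) (c - a)"
    "cross2 (a - b) (c - b) = - cross2 (b - a) (c - a)"
    "cross2 (b - c) (a - c) = - cross2 (b - a) (c - a)"
    "cross2 (c - a) (b - a) = - cross2 (b - a) (c - a)"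
    by (simp_all add: cross2_def algebra_simps)
  have U: "Upsilon s a (affine hull {a, b}) ?P = ?e" "Upsilon s b (affine hull {a, b}) ?P = - ?e"
    "Upsilon s b (affine hull {b, c}) ?P = ?e" "Upsilon s c (affine hull {b, c}) ?P = - ?e"
    "Upsilon s c (affine hull {c, a}) ?P = ?e" "Upsilon s a (affine hull {c, a}) ?P = - ?e"
    using Upsilon_triangle[OF nz s] Upsilon_triangle[of c b a s] Upsilon_triangle[of b c a s]
      Upsilon_triangle[of a b c s] Upsilon_triangle[of a c b s] Upsilon_triangle[of c a b s]
      Upsilon_triangle[of b a c s] nz s
    by (simp_all add: cyc insert_commute sgn_minus)
  have "c \<notin> affine hull {a, b}" "a \<notin> affine hull {b, c}" "b \<notin> affine hull {c, a}"
    using indep nz by (simp_all add: affine_hull_2_cross2 cyc)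
  then have lines: "affine hull {a, b} \<noteq> affine hull {b, c}" "affine hull {b, c} \<noteq> affine hull {c, a}"
    "affine hull {a, b} \<noteq> affine hull {c, a}"
    by (metis hull_inc insertCI)+
  show ?thesis
    unfolding flag_valuation_def Upsilon_triangle_support[OF nz s]
    using indep(2-4) lines by (simp add: U edge_increment_def algebra_simps)
qed

text \<open>Two full-dimensional simplices of a triangulation meet in a common face; if their interiors
  intersect, then this face is full-dimensional and equals both of them.\<close>

lemma convex_polygon_triangulation:
  assumes P: "convex_polygon P"
  obtains \<T> where "finite \<T>" "P = \<Union>\<T>" "pairwise (\<lambda>Q R. interior Q \<inter> interior R = {}) \<T>"
    "\<And>Q. Q \<in> \<T> \<Longrightarrow> \<exists>a b c. cross2 (b - a) (c - a) \<noteq> 0 \<and> Q = convex hull {a, b, c}"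
proof -
  have "polytope P" "convex P" using P convex_polygon_imp by (auto simp: convex_polygon_def)
  then obtain \<T> where T: "triangulation \<T>" "\<And>K. K \<in> \<T> \<Longrightarrow> aff_dim K = 2" "\<Union>\<T> = P"
  proof -
    show thesis
      by (rule fine_triangular_subdivision_of_cell_complex[of 1 "{P}" 2])
        (use that \<open>polytope P\<close> \<open>convex P\<close> convex_polygon_imp(4)[OF P] in \<open>auto simp: face_of_refl\<close>)
  qed
  show thesis
  proof (rule that)
    show "finite \<T>" using T(1) by (simp add: triangulation_def)
    show "P = \<Union>\<T>" using T(3) by simp
    show "pairwise (\<lambda>Q R. interior Q \<inter> interior R = {}) \<T>"
    proof (rule pairwiseI, rule ccontr)
      fix Q R assume QR: "Q \<in> \<T>" "R \<in> \<T>" "Q \<noteq> R" "interior Q \<inter> interior R \<noteq> {}"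
      then have "interior (Q \<inter> R) \<noteq> {}" by (simp add: interior_Int)
      then have dim: "aff_dim (Q \<inter> R) = 2" using aff_dim_nonempty_interior by fastforce
      have "K \<inter> M = K" if "K \<in> \<T>" "M \<in> \<T>" "aff_dim (K \<inter> M) = 2" for K M
      proof (rule ccontr)
        assume "K \<inter> M \<noteq> K"
        moreover have "K \<inter> M face_of K" "convex K"
          using T(1) that convex_simplex unfolding triangulation_def by blast+
        ultimately have "aff_dim (K \<inter> M) < aff_dim K" using face_of_aff_dim_lt by blast
        then show False using that T(2) by simp
      qed
      from this[OF QR(1,2) dim] this[OF QR(2,1)] dim QR(3) show False by (simp add: Int_commute)
    qed
    fix Q assume Q: "Q \<in> \<T>"
    then obtain n where n: "n simplex Q" using T(1) by (auto simp: triangulation_def)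
    then have "n = 2" using aff_dim_simplex[OF n] T(2)[OF Q] by simp
    then obtain C where C: "\<not> affine_dependent C" "card C = 3" "Q = convex hull C"
      using n unfolding simplex_def by auto
    then obtain a b c where abc: "C = {a, b, c}" "a \<noteq> b" "b \<noteq> c" "a \<noteq> c"
      unfolding card_3_iff by blast
    then have "cross2 (b - a) (c - a) \<noteq> 0"
      using C(1) collinear_3_eq_affine_dependent[of a b c]
      unfolding collinear_iff_cross2 [symmetric] by auto
    then show "\<exists>a b c. cross2 (b - a) (c - a) \<noteq> 0 \<and> Q = convex hull {a, b, c}"
      using C(3) abc(1) by blast
  qed
qed

section \<open>Polynomiality modulo low degree\<close>

text \<open>Equality modulo polynomial functions of degree at most \<open>d\<close>.\<close>

definition poly_cong :: "nat \<Rightarrow> ('a::ab_group_add \<Rightarrow> real) \<Rightarrow> ('a \<Rightarrow> real) \<Rightarrow> bool" where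
  "poly_cong d \<phi> \<psi> \<longleftrightarrow> poly_deg_le d (\<lambda>x. \<phi> x - \<psi> x)"

lemma poly_cong_refl [simp]: "poly_cong d \<phi> \<phi>"
  by (simp add: poly_cong_def)

lemma poly_cong_sym: "poly_cong d \<phi> \<psi> \<Longrightarrow> poly_cong d \<psi> \<phi>"
  using poly_deg_le_uminus[of d "\<lambda>x. \<phi> x - \<psi> x"] by (simp add: poly_cong_def)

lemma poly_cong_trans [trans]:
  "poly_cong d \<phi> \<psi> \<Longrightarrow> poly_cong d \<psi> \<theta> \<Longrightarrow> poly_cong d \<phi> \<theta>"
  using poly_deg_le_add[of d "\<lambda>x. \<phi> x - \<psi> x" "\<lambda>x. \<psi> x - \<theta> x"] by (simp add: poly_cong_def)

lemma poly_cong_add: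
  "poly_cong d \<phi> \<phi>' \<Longrightarrow> poly_cong d \<psi> \<psi>' \<Longrightarrow> poly_cong d (\<lambda>x. \<phi> x + \<psi> x) (\<lambda>x. \<phi>' x + \<psi>' x)"
  using poly_deg_le_add[of d "\<lambda>x. \<phi> x - \<phi>' x" "\<lambda>x. \<psi> x - \<psi>' x"]
  by (simp add: poly_cong_def algebra_simps)

lemma poly_cong_shift: "poly_cong d \<phi> \<psi> \<Longrightarrow> poly_cong d (\<lambda>x. \<phi> (x + c)) (\<lambda>x. \<psi> (x + c))"
  using poly_deg_le_shift[of d "\<lambda>x. \<phi> x - \<psi> x" c] by (simp add: poly_cong_def)

lemma poly_cong_iff: "poly_cong d \<phi> \<psi> \<Longrightarrow> poly_deg_le d \<phi> \<longleftrightarrow> poly_deg_le d \<psi>"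
  using poly_deg_le_add[of d "\<lambda>x. \<phi> x - \<psi> x" \<psi>] poly_deg_le_diff[of d \<phi> "\<lambda>x. \<phi> x - \<psi> x"]
  by (auto simp: poly_cong_def)

text \<open>For \<open>\<phi>\<close> of degree at most \<open>d + 2\<close>, second differences are negligible modulo degree \<open>d\<close>; hence first
  differences are translation invariant and, as the next lemma says, additive in the direction.\<close>

lemma poly_cong_Delta_shift:
  assumes "poly_deg_le (d + 2) \<phi>"
  shows "poly_cong d (\<lambda>x. Delta a \<phi> (x + c)) (Delta a \<phi>)"
proof -
  have "poly_deg_le d (Delta c (Delta a \<phi>))" using assms by simp
  then show ?thesis by (simp add: poly_cong_def Delta_def)
qed

lemma poly_cong_Delta_plus:
  assumes "poly_deg_le (d + 2) \<phi>"
  shows "poly_cong d (Delta (a + b) \<phi>) (\<lambda>x. Delta a \<phi> x + Delta b \<phi> x)"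
  unfolding Delta_plus
  by (intro poly_cong_add poly_cong_refl poly_cong_Delta_shift assms)

text \<open>The contribution of an edge with direction \<open>e\<close>, as a function of the initial point of the edge.\<close>

definition increment :: "(real^2 \<Rightarrow> (real^2) set \<Rightarrow> real) \<Rightarrow> real^2 \<Rightarrow> real^2 \<Rightarrow> real" where
  "increment f e = Delta e (flag_slice f (line_to e))"

lemma edge_increment_translate: "edge_increment f (v + a) (v + b) = increment f (b - a) (v + a)"
proof -
  have tr: "(+) c ` (affine hull {0, e}) = affine hull {c, c + e}" for c e :: "real^2"
    using affine_hull_translation[of c "{0, e}"] by simp
  have "affine hull {c, c + e} = affine hull {c + e, c + e + e}" for c e :: "real^2"
  proof (cases "e = 0")
    case False
    have "c + e + e = c + 2 *\<^sub>R (c + e - c)" by (simp add: scaleR_2)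
    then have "c + e + e \<in> affine hull {c, c + e}" unfolding affine_hull_2_param by blast
    then show ?thesis
      using False
      by (intro affine_line_eq_affine_hull_2) (auto simp: affine_line_affine_hull_2 hull_inc)
  qed simp
  from this[of "v + a" "b - a"] show ?thesis
    unfolding edge_increment_def increment_def Delta_def flag_slice_def line_to_def tr
    by (simp add: algebra_simps)
qed

text \<open>The sum of the contributions of the sides \<open>g\<close>, \<open>h\<close>, \<open>- (g + h)\<close> of a triangle, as a function of the
  initial point of \<open>g\<close>. It measures how far \<^const>\<open>increment\<close> is from satisfying the cocycle
  relation.\<close>

definition triangle_cocycle ::
  "(real^2 \<Rightarrow> (real^2) set \<Rightarrow> real) \<Rightarrow> real^2 \<Rightarrow> real^2 \<Rightarrow> real^2 \<Rightarrow> real" where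
  "triangle_cocycle f g h = (\<lambda>x. increment f g x + increment f h (x + g) - increment f (g + h) x)"

lemma increment_uminus: "increment f (- e) (x + e) = - increment f e x"
proof -
  have "edge_increment f (x + e) (x + 0) = - edge_increment f (x + 0) (x + e)"
    by (simp add: edge_increment_def insert_commute)
  then show ?thesis unfolding edge_increment_translate by simp
qed

lemma flag_valuation_triangle_translate:
  assumes nz: "cross2 (b - a) (c - a) \<noteq> 0" and s: "s \<noteq> 0"
  shows "flag_valuation s f ((+) v ` (convex hull {a, b, c})) =
    - sgn (s * cross2 (b - a) (c - a)) * triangle_cocycle f (b - a) (c - b) (v + a)"
proof -
  let ?e = "sgn (s * cross2 (b - a) (c - a))"
  have reversed: "increment f (a - c) (v + c) = - increment f (c - a) (v + a)"
    using increment_uminus[of f "c - a" "v + a"] by simp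
  have "(+) v ` (convex hull {a, b, c}) = convex hull {v + a, v + b, v + c}"
    using convex_hull_translation[of v "{a, b, c}"] by simp
  then have "flag_valuation s f ((+) v ` (convex hull {a, b, c})) =
      flag_valuation s f (convex hull {v + a, v + b, v + c})" by simp
  also have "\<dots> = - ?e * (edge_increment f (v + a) (v + b) + edge_increment f (v + b) (v + c)
      + edge_increment f (v + c) (v + a))"
    using flag_valuation_triangle[of "v + b" "v + a" "v + c" s f] nz s by simp
  also have "\<dots> = - ?e * triangle_cocycle f (b - a) (c - b) (v + a)"
    unfolding edge_increment_translate reversed triangle_cocycle_def by simp
  finally show ?thesis .
qed

text \<open>All three sides lie on one line, so that their increments of the same slice telescope.\<close>

lemma triangle_cocycle_collinear:
  assumes "cross2 g h = 0"
  shows "triangle_cocycle f g h = (\<lambda>x. 0)"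
proof
  fix x
  \<comment> \<open>A common direction \<open>e\<close>, which is arbitrary if both vectors vanish.\<close>
  obtain e s t where e: "e \<noteq> 0" "g = s *\<^sub>R e" "h = t *\<^sub>R e"
  proof (cases "g = 0")
    case g: True
    show thesis
    proof (cases "h = 0")
      case True
      show thesis by (rule that[of "axis 1 1" 0 0]) (simp_all add: g True axis_eq_0_iff)
    next
      case False
      show thesis by (rule that[of h 0 1]) (simp_all add: g False)
    qed
  next
    case False
    then obtain t where "h = t *\<^sub>R g" using assms cross2_eq_0_iff_parallel by blast
    with False show thesis by (intro that[of g 1 t]) simp_all
  qed
  let ?F = "flag_slice f (line_to e)"
  have inc: "increment f (r *\<^sub>R e) = Delta (r *\<^sub>R e) ?F" for r
  proof (cases "r = 0")
    case True
    then show ?thesis by (simp add: increment_def)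
  next
    case False
    have "r *\<^sub>R e \<in> affine hull {0, e}" by (auto simp: affine_hull_2_param)
    then have "line_to (r *\<^sub>R e) = line_to e"
      unfolding line_to_def using e(1) False
      by (intro affine_line_eq_affine_hull_2 [symmetric])
        (auto simp: affine_line_affine_hull_2 hull_inc)
    then show ?thesis by (simp add: increment_def)
  qed
  have "increment f (g + h) = Delta (g + h) ?F"
    unfolding e(2,3) scaleR_add_left [symmetric] by (rule inc)
  then show "triangle_cocycle f g h x = 0"
    by (simp add: triangle_cocycle_def inc[of s, folded e(2)] inc[of t, folded e(3)] Delta_plus)
qed

text \<open>Degenerate triangles contribute nothing and arbitrary polygons are cut into triangles, so
  polynomiality of the valuation says exactly that \<^const>\<open>increment\<close> is additive modulo
  polynomials of degree at most \<open>d\<close>.\<close>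

lemma poly_valuation_iff_cocycle:
  assumes s: "s \<noteq> 0"
  shows "poly_valuation_deg_le d (flag_valuation s f) \<longleftrightarrow>
    (\<forall>g h. poly_deg_le d (triangle_cocycle f g h))"
proof (intro iffI allI)
  fix g h
  assume val: "poly_valuation_deg_le d (flag_valuation s f)"
  show "poly_deg_le d (triangle_cocycle f g h)"
  proof (cases "cross2 g h = 0")
    case True
    then show ?thesis by (simp add: triangle_cocycle_collinear)
  next
    case False
    \<comment> \<open>The triangle with vertices \<open>0\<close>, \<open>g\<close>, \<open>g + h\<close> gives the cocycle up to the sign \<open>?e\<close>.\<close>
    let ?e = "sgn (s * cross2 g h)"
    have nz: "cross2 (g - 0) (g + h - 0) \<noteq> 0" using False by (simp add: cross2_simps)
    have e: "?e * ?e = 1" using False s by (simp add: sgn_if)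
    have "poly_deg_le d (\<lambda>v. flag_valuation s f ((+) v ` (convex hull {0, g, g + h})))"
      using val convex_polygon_triangle[OF nz] by (simp add: poly_valuation_deg_le_def)
    then have "poly_deg_le d (\<lambda>v. - ?e * triangle_cocycle f g h v)"
      unfolding flag_valuation_triangle_translate[OF nz s] by (simp add: cross2_simps)
    from poly_deg_le_scale[OF this, of "- ?e"] show ?thesis
      using e by (simp add: mult.assoc [symmetric])
  qed
next
  assume coc: "\<forall>g h. poly_deg_le d (triangle_cocycle f g h)"
  note simple = simple_valuation_flag_valuation[OF s, of f]
  have "poly_deg_le d (\<lambda>v. flag_valuation s f ((+) v ` P))" if P: "convex_polygon P" for P
  proof -
    obtain \<T> where T: "finite \<T>" "P = \<Union>\<T>" "pairwise (\<lambda>Q R. interior Q \<inter> interior R = {}) \<T>"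
      and tri: "\<And>Q. Q \<in> \<T> \<Longrightarrow> \<exists>a b c. cross2 (b - a) (c - a) \<noteq> 0 \<and> Q = convex hull {a, b, c}"
      using convex_polygon_triangulation[OF P] by blast
    have move: "convex_polygon ((+) v ` Q)" if "convex_polygon Q" for v Q
      using that by (simp add: convex_polygon_def interior_translation polytope_translation_eq)
    have polyT: "convex_polygon Q" if "Q \<in> \<T>" for Q
      using tri[OF that] convex_polygon_triangle by blast
    have "flag_valuation s f ((+) v ` P) = (\<Sum>Q\<in>\<T>. flag_valuation s f ((+) v ` Q))" for v
    proof -
      let ?tr = "(`) ((+) v)"
      have "flag_valuation s f (?tr P) = (\<Sum>Q\<in>?tr ` \<T>. flag_valuation s f Q)"
      proof (rule simple[unfolded simple_valuation_def, rule_format], intro conjI)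
        show "pairwise (\<lambda>Q R. interior Q \<inter> interior R = {}) (?tr ` \<T>)"
          using T(3) by (force simp: pairwise_def interior_translation)
      qed (use T P polyT move in auto)
      also have "\<dots> = (\<Sum>Q\<in>\<T>. flag_valuation s f (?tr Q))"
        by (rule sum.reindex_cong[of ?tr]) (auto simp: inj_on_def inj_image_eq_iff)
      finally show ?thesis .
    qed
    moreover have "poly_deg_le d (\<lambda>v. flag_valuation s f ((+) v ` Q))" if Q: "Q \<in> \<T>" for Q
    proof -
      obtain a b c where nz: "cross2 (b - a) (c - a) \<noteq> 0" and Qeq: "Q = convex hull {a, b, c}"
        using tri[OF Q] by blast
      show ?thesis
        unfolding Qeq flag_valuation_triangle_translate[OF nz s]
        using coc by (intro poly_deg_le_scale poly_deg_le_shift) blast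
    qed
    ultimately show ?thesis by (simp add: poly_deg_le_sum)
  qed
  then show "poly_valuation_deg_le d (flag_valuation s f)"
    using simple by (simp add: poly_valuation_deg_le_def)
qed

section \<open>The criterion for normalized functions\<close>

lemma subspace_affine_line: "affine_line L \<Longrightarrow> 0 \<in> L \<Longrightarrow> subspace L"
  by (simp add: affine_line_def subspace_affine)

lemma affine_lines_complementary:
  assumes L: "affine_line L" "0 \<in> L" and M: "affine_line M" "0 \<in> M" and ne: "L \<noteq> M"
  shows "\<exists>a\<in>L. \<exists>b\<in>M. x = a + b"
proof -
  obtain u where u: "u \<noteq> 0" "L = affine hull {0, u}" using affine_lineE[OF L] by blast
  obtain w where w: "w \<noteq> 0" "M = affine hull {0, w}" using affine_lineE[OF M] by blast
  have "cross2 u w \<noteq> 0"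
  proof
    assume "cross2 u w = 0"
    then have "w \<in> L" using u affine_hull_2_cross2[of 0 u] by simp
    then have "L = affine hull {0, w}" using affine_line_eq_affine_hull_2[OF L] w(1) by blast
    then show False using ne w(2) by simp
  qed
  note expansion = cross2_basis_expansion[OF this, of x]
  have "c *\<^sub>R u \<in> L" "c *\<^sub>R w \<in> M" for c
    using subspace_affine_line[OF L] subspace_affine_line[OF M] u(2) w(2)
    by (simp_all add: subspace_scale hull_inc)
  with expansion show ?thesis by blast
qed

lemma increment_eq_Delta_slice:
  assumes "affine_line L" "0 \<in> L" "a \<in> L"
  shows "increment f a = Delta a (flag_slice f L)"
proof (cases "a = 0")
  case False
  then have "line_to a = L"
    unfolding line_to_def using affine_line_eq_affine_hull_2[OF assms] by simp
  then show ?thesis by (simp add: increment_def)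
qed (simp add: increment_def)

text \<open>The three clauses of normalization, read as statements on slices. The flag \<open>(x, x + L\<^sub>0)\<close> falls under
  the second clause only if \<open>x + L\<^sub>0 = L\<^sub>0\<close>, so this clause makes \<open>f\<^bsub>L\<^sub>0\<^esub>\<close> vanish on \<open>L\<^sub>0\<close> but not
  elsewhere.\<close>

lemma
  assumes norm: "normalized L\<^sub>0 L\<^sub>1 f"
  shows flag_slice_vertical_line: "affine_line L\<^sub>1 \<Longrightarrow> 0 \<in> L\<^sub>1 \<Longrightarrow> flag_slice f L\<^sub>1 x = 0"
    and flag_slice_on_horizontal: "affine_line L\<^sub>0 \<Longrightarrow> 0 \<in> L\<^sub>0 \<Longrightarrow> x \<in> L\<^sub>0 \<Longrightarrow> flag_slice f L\<^sub>0 x = 0"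
    and flag_slice_on_vertical: "affine_line L \<Longrightarrow> 0 \<in> L \<Longrightarrow> x \<in> L\<^sub>1 \<Longrightarrow> flag_slice f L x = 0"
proof -
  have flag: "(x, (+) x ` L) \<in> flags" if "affine_line L" "0 \<in> L" for L x
    using that affine_translation[of L x]
    by (auto simp: flags_def affine_line_def aff_dim_translation_eq image_iff)
  have zero: "f a L = 0" if "(a, L) \<in> flags" "affine_parallel L L\<^sub>1 \<or> L = L\<^sub>0 \<or> a \<in> L\<^sub>1" for a L
    using norm that unfolding normalized_def by blast
  show "flag_slice f L\<^sub>1 x = 0" if "affine_line L\<^sub>1" "0 \<in> L\<^sub>1"
    unfolding flag_slice_def using flag[OF that]
    by (intro zero) (auto simp: affine_parallel_def image_image intro!: exI[of _ "- x"])
  show "flag_slice f L\<^sub>0 x = 0" if "affine_line L\<^sub>0" "0 \<in> L\<^sub>0" "x \<in> L\<^sub>0"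
  proof -
    have "(+) x ` L\<^sub>0 = L\<^sub>0"
    proof (intro equalityI subsetI)
      fix y assume "y \<in> L\<^sub>0"
      then have "y - x \<in> L\<^sub>0"
        using subspace_diff[OF subspace_affine_line[OF that(1,2)]] that(3) by blast
      then show "y \<in> (+) x ` L\<^sub>0" by (auto intro!: image_eqI[of _ _ "y - x"])
    qed (use subspace_add[OF subspace_affine_line[OF that(1,2)]] that(3) in blast)
    then show ?thesis unfolding flag_slice_def using flag[OF that(1,2), of x] by (intro zero) auto
  qed
  show "flag_slice f L x = 0" if "affine_line L" "0 \<in> L" "x \<in> L\<^sub>1"
    unfolding flag_slice_def using flag[OF that(1,2), of x] that(3) by (intro zero) auto
qed

text \<open>In the triangle with sides \<open>b\<close>, \<open>a - b\<close>, \<open>- a\<close>, the vertical side contributes nothing.\<close>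

lemma cocycle_imp_cong_vertical:
  assumes coc: "\<And>g h. poly_deg_le d (triangle_cocycle f g h)"
    and norm: "normalized L\<^sub>0 L\<^sub>1 f" and L1: "affine_line L\<^sub>1" "0 \<in> L\<^sub>1"
    and ab: "a - b \<in> L\<^sub>1"
  shows "poly_cong d (increment f a) (increment f b)"
proof -
  have "flag_slice f L\<^sub>1 = (\<lambda>x. 0)" using flag_slice_vertical_line[OF norm L1] by auto
  then have "increment f (a - b) = (\<lambda>x. 0)"
    using increment_eq_Delta_slice[OF L1 ab] by (simp add: Delta_def)
  then have "triangle_cocycle f b (a - b) = (\<lambda>x. increment f b x - increment f a x)"
    by (simp add: triangle_cocycle_def)
  with coc[of b "a - b"] have "poly_cong d (increment f b) (increment f a)"
    by (simp add: poly_cong_def)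
  then show ?thesis by (rule poly_cong_sym)
qed

text \<open>The degree bound is raised twice by \<open>poly_deg_le_Suc_if_complement\<close>. For horizontal \<open>k\<close>, the function
  \<open>increment f k\<close> vanishes on \<open>L\<^sub>0\<close> and its vertical differences have degree at most \<open>d\<close>, so it has degree
  at most \<open>d + 1\<close>; modulo degree \<open>d\<close> every increment is of this form. Each slice vanishes on
  \<open>L\<^sub>1\<close> and its differences along its line are increments.\<close>

lemma cocycle_imp_poly_deg_slice:
  assumes coc: "\<And>g h. poly_deg_le d (triangle_cocycle f g h)"
    and norm: "normalized L\<^sub>0 L\<^sub>1 f" and L0: "affine_line L\<^sub>0" "0 \<in> L\<^sub>0"
    and L1: "affine_line L\<^sub>1" "0 \<in> L\<^sub>1" and ne: "L\<^sub>0 \<noteq> L\<^sub>1"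
    and L: "affine_line L" "0 \<in> L"
  shows "poly_deg_le (d + 2) (flag_slice f L)"
proof -
  note cong = cocycle_imp_cong_vertical[OF coc norm L1]
  have add: "a + b \<in> M" if "affine_line M" "0 \<in> M" "a \<in> M" "b \<in> M" for a b and M :: "(real^2) set"
    using subspace_add[OF subspace_affine_line] that by blast
  \<comment> \<open>The triangle with sides \<open>w\<close>, \<open>k\<close>, \<open>- (w + k)\<close>, where \<open>w\<close> contributes nothing and the last side may
      be replaced by \<open>- k\<close>.\<close>
  have vertical_diff: "poly_deg_le d (Delta w (increment f k))" if w: "w \<in> L\<^sub>1" for w k
  proof -
    have "increment f w = (\<lambda>x. 0)"
      using increment_eq_Delta_slice[OF L1 w] flag_slice_vertical_line[OF norm L1]
      by (simp add: Delta_def)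
    then have "poly_cong d (\<lambda>x. increment f k (x + w)) (increment f (w + k))"
      using coc[of w k] by (simp add: triangle_cocycle_def poly_cong_def)
    also have "poly_cong d \<dots> (increment f k)" using w by (intro cong) simp
    finally show ?thesis by (simp add: poly_cong_def Delta_def)
  qed
  have horizontal: "poly_deg_le (Suc d) (increment f k)" if k: "k \<in> L\<^sub>0" for k
  proof (rule poly_deg_le_Suc_if_complement[where A = L\<^sub>1 and B = L\<^sub>0])
    show "\<exists>a\<in>L\<^sub>1. \<exists>b\<in>L\<^sub>0. x = a + b" for x
      using affine_lines_complementary[OF L1 L0] ne by blast
    show "increment f k b = 0" if "b \<in> L\<^sub>0" for b
      using flag_slice_on_horizontal[OF norm L0] add[OF L0 that k] that
      by (simp add: increment_eq_Delta_slice[OF L0 k] Delta_def)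
  qed (use add[OF L0] vertical_diff in auto)
  have any: "poly_deg_le (Suc d) (increment f a)" for a
  proof -
    obtain h w where hw: "h \<in> L\<^sub>0" "w \<in> L\<^sub>1" "a = h + w"
      using affine_lines_complementary[OF L0 L1 ne] by blast
    then have "poly_cong d (increment f a) (increment f h)" by (intro cong) simp
    then have "poly_cong (Suc d) (increment f a) (increment f h)"
      unfolding poly_cong_def by (rule poly_deg_le_SucI)
    then show ?thesis using poly_cong_iff horizontal[OF hw(1)] by blast
  qed
  show ?thesis
  proof (cases "L = L\<^sub>1")
    case True
    then have "flag_slice f L = (\<lambda>x. 0)" using flag_slice_vertical_line[OF norm L1] by auto
    then show ?thesis by (simp only: poly_deg_le_const)
  next
    case False
    have "poly_deg_le (Suc (Suc d)) (flag_slice f L)"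
    proof (rule poly_deg_le_Suc_if_complement[where A = L and B = L\<^sub>1])
      show "\<exists>a\<in>L. \<exists>b\<in>L\<^sub>1. x = a + b" for x
        using affine_lines_complementary[OF L L1 False] by blast
      show "poly_deg_le (Suc d) (Delta a (flag_slice f L))" if "a \<in> L" for a
        using any[of a] increment_eq_Delta_slice[OF L that] by simp
    qed (use add[OF L1] flag_slice_on_vertical[OF norm L] in auto)
    then show ?thesis by simp
  qed
qed

text \<open>Each side may be replaced by its horizontal projection, and the horizontal increments come from a
  single function of degree at most \<open>d + 2\<close>, so that they are additive modulo degree \<open>d\<close>.\<close>

lemma cocycle_if_cong_vertical:
  assumes L0: "affine_line L\<^sub>0" "0 \<in> L\<^sub>0" and L1: "affine_line L\<^sub>1" "0 \<in> L\<^sub>1" and ne: "L\<^sub>0 \<noteq> L\<^sub>1"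
    and deg: "poly_deg_le (d + 2) (flag_slice f L\<^sub>0)"
    and cong: "\<And>a b. a - b \<in> L\<^sub>1 \<Longrightarrow> poly_cong d (increment f a) (increment f b)"
  shows "poly_deg_le d (triangle_cocycle f g h)"
proof -
  let ?F = "flag_slice f L\<^sub>0"
  have horizontal: "poly_cong d (increment f a) (Delta k ?F)" if "k \<in> L\<^sub>0" "a - k \<in> L\<^sub>1" for a k
    using cong[OF that(2)] increment_eq_Delta_slice[OF L0 that(1)] by simp
  obtain p v where p: "p \<in> L\<^sub>0" "v \<in> L\<^sub>1" "g = p + v"
    using affine_lines_complementary[OF L0 L1 ne] by blast
  obtain q w where q: "q \<in> L\<^sub>0" "w \<in> L\<^sub>1" "h = q + w"
    using affine_lines_complementary[OF L0 L1 ne] by blast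
  have sum: "p + q \<in> L\<^sub>0" "v + w \<in> L\<^sub>1"
    using p q subspace_add subspace_affine_line L0 L1 by blast+
  have "poly_cong d (\<lambda>x. increment f g x + increment f h (x + g))
      (\<lambda>x. Delta p ?F x + Delta q ?F (x + g))"
    using p q by (intro poly_cong_add poly_cong_shift horizontal) auto
  also have "poly_cong d \<dots> (\<lambda>x. Delta p ?F x + Delta q ?F x)"
    by (intro poly_cong_add poly_cong_refl poly_cong_Delta_shift deg)
  also have "poly_cong d \<dots> (Delta (p + q) ?F)"
    by (rule poly_cong_sym, rule poly_cong_Delta_plus, rule deg)
  also have "poly_cong d \<dots> (increment f (g + h))"
    by (rule poly_cong_sym, rule horizontal) (use sum p(3) q(3) in \<open>simp_all add: algebra_simps\<close>)
  finally show ?thesis by (simp add: poly_cong_def triangle_cocycle_def)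
qed

theorem theorem9p2:
  fixes s :: real and L\<^sub>0 L\<^sub>1 :: "(real^2) set"
    and d :: nat and f :: "real^2 \<Rightarrow> (real^2) set \<Rightarrow> real"
  assumes "s \<in> {1, -1}"
    and "affine_line L\<^sub>0" and "0 \<in> L\<^sub>0"
    and "affine_line L\<^sub>1" and "0 \<in> L\<^sub>1"
    and "L\<^sub>0 \<noteq> L\<^sub>1"
    and "normalized L\<^sub>0 L\<^sub>1 f"
  shows "poly_valuation_deg_le d (flag_valuation s f) \<longleftrightarrow>
     (\<forall>L. affine_line L \<and> 0 \<in> L \<longrightarrow> poly_deg_le (d + 2) (flag_slice f L)) \<and>
     (\<forall>a b. a - b \<in> L\<^sub>1 \<longrightarrow>
        poly_deg_le d (\<lambda>x. Delta a (flag_slice f (line_to a)) x - Delta b (flag_slice f (line_to b)) x))"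
proof -
  have s: "s \<noteq> 0" using assms(1) by auto
  show ?thesis
    unfolding poly_valuation_iff_cocycle[OF s] increment_def [symmetric] poly_cong_def [symmetric]
  proof (intro iffI conjI allI impI)
    fix L assume "\<forall>g h. poly_deg_le d (triangle_cocycle f g h)" "affine_line L \<and> 0 \<in> L"
    then show "poly_deg_le (d + 2) (flag_slice f L)"
      using cocycle_imp_poly_deg_slice[OF _ assms(7,2-6)] by blast
  next
    fix a b assume "\<forall>g h. poly_deg_le d (triangle_cocycle f g h)" "a - b \<in> L\<^sub>1"
    then show "poly_cong d (increment f a) (increment f b)"
      using cocycle_imp_cong_vertical[OF _ assms(7,4,5)] by blast
  next
    fix g h assume "(\<forall>L. affine_line L \<and> 0 \<in> L \<longrightarrow> poly_deg_le (d + 2) (flag_slice f L)) \<and>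
      (\<forall>a b. a - b \<in> L\<^sub>1 \<longrightarrow> poly_cong d (increment f a) (increment f b))"
    then show "poly_deg_le d (triangle_cocycle f g h)"
      using cocycle_if_cong_vertical[OF assms(2-6)] assms(2,3) by blast
  qed
qed

end
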